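(* Let $0<k_1<k_2$. For either choice of sign, the asymptotic behaviors as $t\to\pm\infty$ of the curves $x(t)$ of zeros of $F^{\pm}(\cdot,t)$ are completely described as follows. 1. For every odd integer $m\in\mathbb{Z}$ there exists a unique curve $x_{m,s^-}(t)$ of zeros of $F^{\pm}(\cdot,t)$ such that $$x_{m,s^-}(t)=k_1^2t+\frac1{k_1}\log\gamma+\frac{m\pi i}{2k_1}+o(1)\quad\text{as } t\to-\infty.$$ 2. For every odd integer $m\in\mathbb{Z}$ there exists a unique curve $x_{m,s^+}(t)$ of zeros of $F^{\pm}(\cdot,t)$ such that $$x_{m,s^+}(t)=k_1^2t-\frac1{k_1}\log\gamma-\frac{m\pi i}{2k_1}+o(1)\quad\text{as } t\to\infty.$$ 3. For every odd integer $n\in\mathbb{Z}$ there exists a unique curve $x_{n,f^-}(t)$ of zeros of $F^{\pm}(\cdot,t)$ such that $$x_{n,f^-}(t)=k_2^2t-\frac1{k_2}\log\gamma+\frac{n\pi i}{2k_2}+o(1)\quad\text{as } t\to-\infty.$$ 4. For every odd integer $n\in\mathbb{Z}$ there exists a unique curve $x_{n,f^+}(t)$ of zeros of $F^{\pm}(\cdot,t)$ such that $$x_{n,f^+}(t)=k_2^2t+\frac1{k_2}\log\gamma-\frac{n\pi i}{2k_2}+o(1)\quad\text{as } t\to\infty.$$ The description is complete: every curve of zeros of $F^{\pm}(\cdot,t)$ is, as $t\to-\infty$, one of the curves in 1 or 3, and, as $t\to\infty$, one of the curves in 2 or 4.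
   Context: For $0<k_1<k_2$ put $\gamma=\frac{k_2+k_1}{k_2-k_1}$ and $f_j(x,t)=\exp(-k_jx+k_j^3t)$ for $j=1,2$, $x\in\mathbb{C}$, $t\in\mathbb{R}$, and $$F^{\pm}=(1\mp f_1f_2)^2+\gamma^2(f_1\pm f_2)^2 .$$ Call $k_1,k_2$ commensurable if $k_2/k_1=p_2/p_1$ for some positive integers $p_1,p_2$, taken with $\gcd(p_1,p_2)=1$. The exceptional case is: $k_1,k_2$ commensurable, $p_1,p_2$ odd, and $p_2-p_1\in4\mathbb{N}$ when considering $F^-$, respectively $p_2+p_1\in4\mathbb{N}$ when considering $F^+$. A curve of zeros of $F^{\pm}(\cdot,t)$ is an analytic function $t\mapsto x(t)\in\mathbb{C}$ with $F^{\pm}(x(t),t)=0$, defined for all $t\in\mathbb{R}$ outside the exceptional case, and, in the exceptional case, defined on $(-\infty,0)$ (when $t\to-\infty$ is considered) or on $(0,\infty)$ (when $t\to\infty$ is considered). It is known that through every zero (at a time $t\neq0$ in the exceptional case) there passes exactly one such curve. *)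

theory Defs
  imports Complex_Main "HOL-Library.FuncSet" "HOL-Library.Landau_Symbols"
begin

definition gam :: "real \<Rightarrow> real \<Rightarrow> real" where
  "gam k1 k2 = (k2 + k1) / (k2 - k1)"

definition expf :: "real \<Rightarrow> complex \<Rightarrow> real \<Rightarrow> complex" where
  "expf k x t = exp (- of_real k * x + of_real (k ^ 3 * t))"

text \<open>The sign in \<open>F\<^sup>\<plusminus>\<close> is an integer \<open>s\<close>, equal to \<open>1\<close> for \<open>F\<^sup>+\<close> and \<open>- 1\<close> for \<open>F\<^sup>-\<close>.\<close>

definition F :: "real \<Rightarrow> real \<Rightarrow> int \<Rightarrow> complex \<Rightarrow> real \<Rightarrow> complex" where
  "F k1 k2 s x t =
     (1 - of_int s * expf k1 x t * expf k2 x t)\<^sup>2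
     + (of_real (gam k1 k2))\<^sup>2 * (expf k1 x t + of_int s * expf k2 x t)\<^sup>2"

text \<open>The last condition reads \<open>4 dvd p2 - p1\<close> for \<open>F\<^sup>-\<close> and \<open>4 dvd p2 + p1\<close> for \<open>F\<^sup>+\<close>.
  For \<open>0 < k1 < k2\<close> both integers are positive.\<close>

definition exceptional :: "real \<Rightarrow> real \<Rightarrow> int \<Rightarrow> bool" where
  "exceptional k1 k2 s \<longleftrightarrow>
     (\<exists>p1 p2 :: nat. 0 < p1 \<and> 0 < p2 \<and> coprime p1 p2 \<and> k2 / k1 = real p2 / real p1 \<and>
        odd p1 \<and> odd p2 \<and> 4 dvd int p2 + s * int p1)"

definition past_domain :: "real \<Rightarrow> real \<Rightarrow> int \<Rightarrow> real set" where
  "past_domain k1 k2 s = (if exceptional k1 k2 s then {..<0} else UNIV)"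

definition future_domain :: "real \<Rightarrow> real \<Rightarrow> int \<Rightarrow> real set" where
  "future_domain k1 k2 s = (if exceptional k1 k2 s then {0<..} else UNIV)"

text \<open>Real analyticity on an open set \<open>I\<close> (the library's \<open>analytic_on\<close> concerns functions of a
  complex variable).\<close>

definition real_analytic_on :: "(real \<Rightarrow> complex) \<Rightarrow> real set \<Rightarrow> bool" where
  "real_analytic_on x I \<longleftrightarrow>
     (\<forall>t0\<in>I. \<exists>(a :: nat \<Rightarrow> complex) r. 0 < r \<and>
        (\<forall>t. \<bar>t - t0\<bar> < r \<longrightarrow> (\<lambda>n. a n * of_real (t - t0) ^ n) sums x t))"

text \<open>A function with domain \<open>I\<close> is represented by a total function that is \<open>undefined\<close> outside
  \<open>I\<close>, so that equality of curves is equality on \<open>I\<close>.\<close>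

definition zero_curve :: "real \<Rightarrow> real \<Rightarrow> int \<Rightarrow> real set \<Rightarrow> (real \<Rightarrow> complex) \<Rightarrow> bool" where
  "zero_curve k1 k2 s I x \<longleftrightarrow>
     x \<in> extensional I \<and> real_analytic_on x I \<and> (\<forall>t\<in>I. F k1 k2 s (x t) t = 0)"

definition slow_past :: "real \<Rightarrow> real \<Rightarrow> int \<Rightarrow> real \<Rightarrow> complex" where
  "slow_past k1 k2 m t =
     of_real (k1\<^sup>2 * t + 1 / k1 * ln (gam k1 k2)) + of_int m * of_real pi * \<i> / (2 * of_real k1)"

definition slow_future :: "real \<Rightarrow> real \<Rightarrow> int \<Rightarrow> real \<Rightarrow> complex" where
  "slow_future k1 k2 m t =
     of_real (k1\<^sup>2 * t - 1 / k1 * ln (gam k1 k2)) - of_int m * of_real pi * \<i> / (2 * of_real k1)"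

definition fast_past :: "real \<Rightarrow> real \<Rightarrow> int \<Rightarrow> real \<Rightarrow> complex" where
  "fast_past k1 k2 n t =
     of_real (k2\<^sup>2 * t - 1 / k2 * ln (gam k1 k2)) + of_int n * of_real pi * \<i> / (2 * of_real k2)"

definition fast_future :: "real \<Rightarrow> real \<Rightarrow> int \<Rightarrow> real \<Rightarrow> complex" where
  "fast_future k1 k2 n t =
     of_real (k2\<^sup>2 * t + 1 / k2 * ln (gam k1 k2)) - of_int n * of_real pi * \<i> / (2 * of_real k2)"

end

theory Submission
  imports Defs "HOL-Complex_Analysis.Conformal_Mappings"
begin

text \<open>
  Write \<open>z\<close>, \<open>w\<close> for the two exponentials and \<open>\<gamma>\<close> for \<open>gam k1 k2\<close>.  The sum of two squares \<open>F\<close> splits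
  into two factors, indexed by \<open>\<sigma> = \<plusminus>1\<close>, each of which vanishes exactly when \<open>w\<close> is a certain Moebius
  transform of \<open>z\<close>.  All information about the zeros is read off from this relation.

  Zeros form curves.  The logarithms \<open>a\<close>, \<open>b\<close> of \<open>z\<close>, \<open>w\<close> are linearly independent linear functions of
  \<open>(x, t)\<close>, and on the zero set \<open>b\<close> is a holomorphic function of \<open>a\<close>; hence so is \<open>t\<close>.  Its derivative
  vanishes only for \<open>z = \<i> \<sigma>\<close>, that is, at a double zero, and this forces \<open>t = 0\<close> in the exceptional
  case.  Away from these points \<open>t\<close> can be inverted, which presents the zeros locally as the graph
  of a function holomorphic in \<open>t\<close> (\<open>local_branch\<close>, \<open>double_zero_exceptional\<close>).

  Curves are global.  A branch can stop only by leaving every bounded set.  Its real part stays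
  bounded over bounded times, since both exponentials are small or both are large otherwise.  Its imaginary
  part cannot escape because the Moebius relation maps the imaginary axis to itself: the
  horizontal lines on which \<open>w\<close> is imaginary but \<open>z\<close> is not carry no zeros at any time, and such
  lines occur arbitrarily high and low.  So each branch lives in a compact rectangle over every compact
  time interval and continues through the whole domain (\<open>curve_through_zero\<close>).

  As \<open>t \<rightarrow> -\<infinity>\<close>, at every zero \<open>w\<close> or \<open>1 / z\<close> is small, uniformly.  In the first case the relation
  forces \<open>z\<close> close to \<open>\<plusminus>\<i> / \<gamma>\<close>, which places \<open>x\<close> close to a slow center; the second case is the
  first one for the pair \<open>(1 / w, 1 / z)\<close>, which satisfies the same relation, and gives a fast center.  A small
  disc around each center contains exactly one zero, again by local inversion of a holomorphic
  function of one variable (\<open>P_root_near_limit_unique\<close>).  The discs are disjoint, so a continuous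
  curve of zeros is caught in one of them for all early times, and the curve is determined by the disc
  (locale \<open>tracked_zeros\<close>).  The behavior for \<open>t \<rightarrow> \<infinity>\<close> follows from the symmetry
  \<open>(x, t) \<mapsto> (- x, - t)\<close>.
\<close>

section \<open>The two exponentials and their polynomial relation\<close>

definition P :: "real \<Rightarrow> int \<Rightarrow> complex \<Rightarrow> complex \<Rightarrow> complex" where
  "P g s z w = (1 - of_int s * z * w)\<^sup>2 + (of_real g)\<^sup>2 * (z + of_int s * w)\<^sup>2"

lemma F_eq_P: "F k1 k2 s x t = P (gam k1 k2) s (expf k1 x t) (expf k2 x t)"
  by (simp add: F_def P_def)

text \<open>The factorization of the sum of two squares over \<open>\<i>\<close>.  Each of the two relations is fractional linear
  in \<open>z\<close> and in \<open>w\<close>.\<close>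

lemma P_eq_0_iff:
  "P g s z w = 0 \<longleftrightarrow>
     (\<exists>\<sigma>\<in>{1, -1}. of_int s * w * (z - \<i> * \<sigma> * of_real g) = 1 + \<i> * \<sigma> * of_real g * z)"
proof -
  have "P g s z w =
      (1 + \<i> * 1 * of_real g * z - of_int s * w * (z - \<i> * 1 * of_real g)) *
      (1 + \<i> * (-1) * of_real g * z - of_int s * w * (z - \<i> * (-1) * of_real g))"
    by (simp add: P_def algebra_simps power2_eq_square)
  then show ?thesis
    unfolding mult_eq_0_iff by (simp only: bex_simps ball_simps insert_iff empty_iff mult_eq_0_iff right_minus_eq)
      (metis)
qed

text \<open>This symmetry interchanges the roles of a small \<open>w\<close> and a large \<open>z\<close>; it reduces fast zeros to slow
  ones.\<close>

lemma P_inverse: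
  assumes "s = 1 \<or> s = -1" and "z \<noteq> 0" and "w \<noteq> 0"
  shows "P g s (1 / w) (1 / z) = 0 \<longleftrightarrow> P g s z w = 0"
proof -
  have "P g s z w = (z * w)\<^sup>2 * P g s (1 / w) (1 / z)"
    using assms by (auto simp: P_def field_simps power2_eq_square)
  then show ?thesis using assms by simp
qed

text \<open>The Moebius transformation of \<open>P_eq_0_iff\<close> takes \<open>w = \<i> y\<close> to a real number divided by an imaginary
  one.\<close>

lemma P_root_imaginary_axis:
  assumes "P g s z w = 0" and "1 < g" and "s = 1 \<or> s = -1" and "Re w = 0"
  shows "Re z = 0"
proof -
  obtain \<sigma> where \<sigma>: "\<sigma> = 1 \<or> \<sigma> = (-1 :: complex)"
    and eq: "of_int s * w * (z - \<i> * \<sigma> * of_real g) = 1 + \<i> * \<sigma> * of_real g * z"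
    using assms(1) unfolding P_eq_0_iff by blast
  have "Im \<sigma> = 0" using \<sigma> by auto
  then have re: "Im w * of_int s * Re z = Re \<sigma> * g * Re z"
    and im: "Im z * (Im w * of_int s - Re \<sigma> * g) = Re \<sigma> * g * of_int s * Im w - 1"
    using arg_cong[OF eq, of Im] arg_cong[OF eq, of Re] assms(4) by (simp_all add: algebra_simps)
  \<comment> \<open>The pole of the transformation would require \<open>g\<^sup>2 = 1\<close>.\<close>
  have "Im w * of_int s \<noteq> Re \<sigma> * g"
  proof
    assume eq: "Im w * of_int s = Re \<sigma> * g"
    have "Re \<sigma> * g * (Im w * of_int s) = 1"
    proof -
      have "Re \<sigma> * g * of_int s * Im w = 1" using im eq by simp
      then show ?thesis by (simp only: mult_ac)
    qed
    then have "Re \<sigma> * g * (Re \<sigma> * g) = 1" unfolding eq .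
    then have "g * g = 1" using \<sigma> by auto
    then show False using assms(2) by (metis less_1_mult less_irrefl)
  qed
  then show ?thesis using re by simp
qed

text \<open>At \<open>z = w = 0\<close> the factors of \<open>P\<close> equal 1; the constant only has to be small enough to keep them nonzero.\<close>

lemma P_no_small_root:
  assumes "1 < g" and "s = 1 \<or> s = -1" and "norm z \<le> 1 / (4 * g)" and "norm w \<le> 1 / (4 * g)"
  shows "P g s z w \<noteq> 0"
proof
  assume "P g s z w = 0"
  then obtain \<sigma> where \<sigma>: "\<sigma> = 1 \<or> \<sigma> = (-1 :: complex)"
    and eq: "of_int s * w * (z - \<i> * \<sigma> * of_real g) = 1 + \<i> * \<sigma> * of_real g * z"
    unfolding P_eq_0_iff by blast
  have gz: "norm (\<i> * \<sigma> * of_real g * z) = g * norm z"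
    using \<sigma> assms(1) by (auto simp: norm_mult)
  have small: "g * norm z \<le> 1 / 4"
    using assms(1,3) by (simp add: field_simps)
  have "1 / (4 * g) < 1 / 4" using assms(1) by (simp add: field_simps)
  then have z: "norm z \<le> g" using assms by linarith
  have "norm (z - \<i> * \<sigma> * of_real g) \<le> norm z + g"
    using \<sigma> assms(1) norm_triangle_ineq4[of z "\<i> * \<sigma> * of_real g"] by (auto simp: norm_mult)
  then have "norm (z - \<i> * \<sigma> * of_real g) \<le> 2 * g" using z by linarith
  then have "norm w * norm (z - \<i> * \<sigma> * of_real g) \<le> 1 / (4 * g) * (2 * g)"
    using assms by (intro mult_mono) auto
  then have "norm (of_int s * w * (z - \<i> * \<sigma> * of_real g)) \<le> 1 / 2"
    using assms by (auto simp: norm_mult)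
  moreover have "1 - g * norm z \<le> norm (1 + \<i> * \<sigma> * of_real g * z)"
    using norm_diff_ineq[of 1 "\<i> * \<sigma> * of_real g * z"] gz by simp
  ultimately show False using small eq by simp
qed

lemma expf_nonzero [simp]: "expf k x t \<noteq> 0"
  by (simp add: expf_def)

lemma norm_expf: "norm (expf k x t) = exp (- k * Re x + k ^ 3 * t)"
  by (simp add: expf_def)

lemma expf_minus: "expf k (- x) (- t) = 1 / expf k x t"
proof -
  have "expf k (- x) (- t) * expf k x t = 1"
    by (simp add: expf_def flip: exp_add)
  then show ?thesis by (simp add: field_simps)
qed

lemma gam_gt_1: "0 < k1 \<Longrightarrow> k1 < k2 \<Longrightarrow> 1 < gam k1 k2"
  by (simp add: gam_def field_simps)

lemma P_commute: "P g s z w = 0 \<longleftrightarrow> P g s w z = 0" if "s = 1 \<or> s = -1"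
  using that by (auto simp: P_def algebra_simps power2_eq_square)

text \<open>Both exponentials are inverted by \<open>(x, t) \<mapsto> (- x, - t)\<close>, so this is \<open>P_inverse\<close> up to the order of
  the arguments.\<close>

lemma F_minus:
  assumes "s = 1 \<or> s = - 1"
  shows "F k1 k2 s (- x) (- t) = 0 \<longleftrightarrow> F k1 k2 s x t = 0"
  using P_inverse[OF assms, of "expf k1 x t" "expf k2 x t"] P_commute[OF assms]
  by (simp add: F_eq_P expf_minus)

section \<open>Where zeros cannot lie\<close>

lemma Re_expf_eq_0_iff: "Re (expf k x t) = 0 \<longleftrightarrow> cos (k * Im x) = 0"
  by (simp add: expf_def Re_exp)

text \<open>On these horizontal lines the second exponential is imaginary and the first one is not.  No curve of
  zeros crosses such a line, at any time.\<close>

lemma no_zero_on_barrier: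
  assumes "0 < k1" "k1 < k2" "s = 1 \<or> s = - 1"
    and "cos (k2 * Im x) = 0" "cos (k1 * Im x) \<noteq> 0"
  shows "F k1 k2 s x t \<noteq> 0"
  using P_root_imaginary_axis[OF _ gam_gt_1[OF assms(1,2)] assms(3)] assms(4,5)
  by (auto simp: F_eq_P simp flip: Re_expf_eq_0_iff[where t = t])

text \<open>Consecutive zeros of \<open>cos (k2 * y)\<close> differ by \<open>pi / k2\<close>, which is less than the spacing \<open>pi / k1\<close> of
  the zeros of \<open>cos (k1 * y)\<close>; so one of any two consecutive ones is suitable.\<close>

lemma barriers_unbounded:
  fixes k1 k2 Y :: real
  assumes "0 < k1" "k1 < k2"
  obtains y where "y > Y" "cos (k2 * y) = 0" "cos (k1 * y) \<noteq> 0"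
proof -
  obtain n :: nat where n: "real n > \<bar>Y\<bar> * k2"
    using reals_Archimedean2 by blast
  define y where "y = (real n * pi + pi / 2) / k2"
  have k2: "k2 * y = real n * pi + pi / 2" "0 < k2" using assms by (auto simp: y_def)
  have "k2 * (y + pi / k2) = k2 * y + pi" using k2 by (simp add: distrib_left)
  moreover have c1: "cos (k2 * y) = 0" by (simp add: k2(1) cos_add)
  ultimately have c: "cos (k2 * y) = 0" "cos (k2 * (y + pi / k2)) = 0"
    by (simp_all only: cos_periodic_pi minus_zero)
  have "real n \<le> real n * pi"
    using pi_ge_two by (simp add: mult_le_cancel_left1)
  then have "\<bar>Y\<bar> * k2 < k2 * y" using n k2 pi_gt_zero by linarith
  then have Y: "Y < y" using assms by (simp add: mult.commute)
  show thesis
  proof (cases "cos (k1 * y) = 0")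
    case False
    with that c Y show ?thesis by blast
  next
    case True
    then have "sin (k1 * y) \<noteq> 0"
      by (metis sin_zero_norm_cos_one abs_zero norm_zero zero_neq_one)
    moreover have "sin (k1 * pi / k2) \<noteq> 0"
    proof -
      have "0 < k1 * pi / k2" "k1 * pi / k2 < pi"
        using assms by (auto simp: field_simps)
      then show ?thesis using sin_gt_zero by fastforce
    qed
    ultimately have "cos (k1 * (y + pi / k2)) \<noteq> 0"
      using True by (simp add: distrib_left cos_add)
    moreover have "Y < y + pi / k2" using Y k2(2) by (simp add: add_strict_increasing2 field_simps add_pos_pos)
    ultimately show ?thesis using that c by blast
  qed
qed

text \<open>Far to the right both exponentials are small and \<open>P_no_small_root\<close> applies.\<close>

lemma zeros_Re_bounded_above:
  assumes "0 < k1" "k1 < k2" "s = 1 \<or> s = - 1"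
  obtains R where "\<And>x t. \<bar>t\<bar> \<le> T \<Longrightarrow> F k1 k2 s x t = 0 \<Longrightarrow> Re x < R"
proof -
  define g where "g = gam k1 k2"
  have g: "1 < g" using assms gam_gt_1 by (simp add: g_def)
  have small: "norm (expf k x t) \<le> 1 / (4 * g)"
    if "0 < k" "\<bar>t\<bar> \<le> T" "Re x \<ge> k\<^sup>2 * T + ln (4 * g) / k" for k x t
  proof -
    have "k * (k\<^sup>2 * T + ln (4 * g) / k) \<le> k * Re x"
      using that by (intro mult_left_mono) auto
    then have "k ^ 3 * T + ln (4 * g) \<le> k * Re x"
      using that by (simp add: distrib_left power_numeral_reduce)
    moreover have "k ^ 3 * t \<le> k ^ 3 * T" using that by (intro mult_left_mono) auto
    ultimately have "norm (expf k x t) \<le> exp (- ln (4 * g))"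
      by (simp add: norm_expf)
    also have "\<dots> = 1 / (4 * g)" using g by (simp add: exp_minus field_simps)
    finally show ?thesis .
  qed
  show thesis
  proof (rule that[of "max (k1\<^sup>2 * T + ln (4 * g) / k1) (k2\<^sup>2 * T + ln (4 * g) / k2)"], rule ccontr)
    fix x t assume "\<bar>t\<bar> \<le> T" "F k1 k2 s x t = 0"
      "\<not> Re x < max (k1\<^sup>2 * T + ln (4 * g) / k1) (k2\<^sup>2 * T + ln (4 * g) / k2)"
    then show False
      using small[of k1 t x] small[of k2 t x] P_no_small_root[OF g assms(3)] assms
      by (auto simp: F_eq_P g_def not_less)
  qed
qed

lemma zeros_Re_bounded:
  assumes "0 < k1" "k1 < k2" "s = 1 \<or> s = - 1"
  obtains R where "\<And>x t. \<bar>t\<bar> \<le> T \<Longrightarrow> F k1 k2 s x t = 0 \<Longrightarrow> \<bar>Re x\<bar> < R"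
proof -
  obtain R where R: "\<And>x t. \<bar>t\<bar> \<le> T \<Longrightarrow> F k1 k2 s x t = 0 \<Longrightarrow> Re x < R"
    using zeros_Re_bounded_above[OF assms] by metis
  show thesis
  proof (rule that[of R])
    fix x t assume *: "\<bar>t\<bar> \<le> T" "F k1 k2 s x t = 0"
    show "\<bar>Re x\<bar> < R"
      using R[of t x] R[of "- t" "- x"] * F_minus[OF assms(3)] by auto
  qed
qed

section \<open>Double zeros\<close>

text \<open>These equations characterize the multiple zeros of \<open>F\<close> in \<open>x\<close>: both exponentials lie in \<open>{\<i>, - \<i>}\<close>
  and both squares in \<open>F\<close> vanish.\<close>

definition double_zero :: "real \<Rightarrow> real \<Rightarrow> int \<Rightarrow> complex \<Rightarrow> real \<Rightarrow> bool" where
  "double_zero k1 k2 s x t \<longleftrightarrow> (expf k1 x t)\<^sup>2 = - 1 \<and> expf k2 x t = - of_int s * expf k1 x t"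

lemma cos_eq_0_half_pi:
  assumes "cos y = (0::real)" obtains q :: int where "odd q" "y = of_int q * pi / 2"
  using assms unfolding cos_zero_iff_int by (metis times_divide_eq_right)

text \<open>Both exponentials have modulus 1, so \<open>x\<close> has real part \<open>k1\<^sup>2 t = k2\<^sup>2 t\<close>, hence \<open>t = 0\<close> and \<open>x\<close> is imaginary.
  Then \<open>k1 * Im x\<close> and \<open>k2 * Im x\<close> are odd multiples of \<open>pi / 2\<close>, which gives commensurability with
  odd numerator and denominator, and the relation between the two exponentials gives the congruence
  modulo 4.\<close>

lemma double_zero_exceptional:
  assumes k: "0 < k1" "k1 < k2" and s: "s = 1 \<or> s = - 1" and D: "double_zero k1 k2 s x t"
  shows "t = 0 \<and> exceptional k1 k2 s"
proof -
  have f1: "norm (expf k1 x t) = 1"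
    using D by (metis double_zero_def norm_power norm_minus_cancel norm_one power2_eq_1_iff
       norm_ge_zero abs_1 abs_minus_cancel abs_norm_cancel)
  then have "norm (expf k2 x t) = 1"
    using D s by (auto simp: double_zero_def norm_mult)
  with f1 have "k1 * Re x = k1 ^ 3 * t" "k2 * Re x = k2 ^ 3 * t"
    by (simp_all add: norm_expf)
  then have R: "Re x = k1\<^sup>2 * t" "Re x = k2\<^sup>2 * t"
    using k by (auto simp: power_numeral_reduce)
  have "k1\<^sup>2 \<noteq> k2\<^sup>2" using k by (simp add: power2_eq_iff_nonneg)
  with R have t: "t = 0" and x: "Re x = 0" by auto
  define y where "y = Im x"
  have ex: "expf k x t = exp (- \<i> * of_real (k * y))" for k
    by (simp add: expf_def t y_def x complex_eq_iff[of x] exp_eq_polar algebra_simps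
        complex_eq_iff[of "exp _"] Re_exp Im_exp)
  have sq: "(expf k1 x t)\<^sup>2 = -1" "(expf k2 x t)\<^sup>2 = -1"
    using D s by (auto simp: double_zero_def)
  have "cos (k * y) = 0" if "(expf k x t)\<^sup>2 = -1" for k
  proof -
    have "Re (expf k x t) * Re (expf k x t) - Im (expf k x t) * Im (expf k x t) = -1"
         "Re (expf k x t) * Im (expf k x t) = 0"
      using that by (auto simp: complex_eq_iff power2_eq_square)
    then have "Re (expf k x t) = 0"
      by (metis diff_0_right mult_eq_0_iff not_one_le_zero zero_le_square neg_0_le_iff_le zero_le_one)
    then show ?thesis by (simp add: Re_expf_eq_0_iff y_def)
  qed
  with sq obtain q1 q2 :: int where q: "odd q1" "odd q2"
    "k1 * y = of_int q1 * pi / 2" "k2 * y = of_int q2 * pi / 2"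
    by (metis cos_eq_0_half_pi)
  have y0: "y \<noteq> 0" and q0: "q1 \<noteq> 0" "q2 \<noteq> 0" using q by auto
  have ratio: "k2 / k1 = of_int q2 / of_int q1"
  proof -
    have "k2 / k1 = (k2 * y) / (k1 * y)" using y0 by simp
    also have "\<dots> = of_int q2 / of_int q1" by (simp add: q(3,4))
    finally show ?thesis .
  qed
  have four: "4 dvd q2 + s * q1"
  proof -
    have eq: "exp (- \<i> * of_real (k2 * y) + of_int s * (- \<i> * of_real (k1 * y))) = 1"
    proof (cases "s = 1")
      case True
      have "expf k2 x t * expf k1 x t = 1"
        using D True by (simp add: double_zero_def power2_eq_square)
      then show ?thesis using True by (simp add: ex flip: exp_add)
    next
      case False
      then have "s = -1" using s by simp
      moreover have "expf k2 x t / expf k1 x t = 1"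
        using D \<open>s = -1\<close> by (simp add: double_zero_def)
      ultimately show ?thesis by (simp add: ex flip: exp_diff)
    qed
    then obtain n :: int where n: "Im (- \<i> * of_real (k2 * y) + of_int s * (- \<i> * of_real (k1 * y))) = of_int (2 * n) * pi"
      using exp_eq_1 by blast
    then have "- (of_int q2 * pi / 2) - of_int s * (of_int q1 * pi / 2) = of_int (2 * n) * pi"
      using q(3,4) by simp
    then have "pi * of_int (q2 + s * q1) = pi * of_int (- 4 * n)"
      by (simp add: field_simps)
    then have "q2 + s * q1 = - 4 * n"
      by (metis mult_cancel_left of_int_eq_iff pi_neq_zero)
    then show ?thesis by simp
  qed
  \<comment> \<open>The common factor of \<open>q1\<close> and \<open>q2\<close> is odd and can be cancelled in the congruence modulo 4.\<close>
  define d where "d = gcd q1 q2"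
  obtain p1 p2 where p: "q1 = p1 * d" "q2 = p2 * d" "coprime p1 p2"
    using gcd_coprime_exists[of q1 q2] q0 unfolding d_def by (metis gcd_eq_0_iff)
  have d: "odd d" "d \<noteq> 0" using p q by auto
  have "k2 / k1 = of_int p2 / of_int p1" using ratio d by (simp add: p)
  moreover have "0 < k2 / k1" using k by simp
  ultimately have sgn: "0 < p1 \<and> 0 < p2 \<or> p1 < 0 \<and> p2 < 0" by (auto simp: zero_less_divide_iff)
  have "4 dvd (p2 + s * p1) * d" using four by (simp add: p algebra_simps)
  moreover have "coprime (4 :: int) d" using d(1)
    by (metis coprime_left_2_iff_odd coprime_power_left_iff numeral_Bit0 mult_2_right power2_eq_square numeral_times_numeral semiring_norm(11,13))
  ultimately have 4: "4 dvd p2 + s * p1" using coprime_dvd_mult_left_iff by blast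
  have "exceptional k1 k2 s"
    unfolding exceptional_def
  proof (rule exI[of _ "nat \<bar>p1\<bar>"], rule exI[of _ "nat \<bar>p2\<bar>"], intro conjI)
    show "0 < nat \<bar>p1\<bar>" "0 < nat \<bar>p2\<bar>" using sgn by auto
    show "coprime (nat \<bar>p1\<bar>) (nat \<bar>p2\<bar>)" using p(3) by (simp add: coprime_nat_abs_left_iff coprime_nat_abs_right_iff)
    show "k2 / k1 = real (nat \<bar>p2\<bar>) / real (nat \<bar>p1\<bar>)"
      using \<open>k2 / k1 = of_int p2 / of_int p1\<close> sgn by auto
    show "odd (nat \<bar>p1\<bar>)" "odd (nat \<bar>p2\<bar>)" using q p by (auto simp: even_nat_iff)
    show "4 dvd int (nat \<bar>p2\<bar>) + s * int (nat \<bar>p1\<bar>)"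
      using sgn 4 by (auto simp: abs_if) (metis dvd_minus_iff minus_add_distrib mult_minus_right uminus_add_conv_diff)
  qed
  with t show ?thesis by blast
qed

section \<open>Local branches of zeros\<close>

text \<open>The branch \<open>b + Ln (q z / exp b)\<close> of the logarithm of \<open>q\<close> takes the value \<open>b\<close> at \<open>a\<close>, wherever \<open>b\<close>
  lies; near \<open>a\<close> the argument of \<open>Ln\<close> is close to 1.\<close>

lemma has_field_derivative_local_log:
  fixes q :: "complex \<Rightarrow> complex"
  assumes q: "(q has_field_derivative q') (at a)" and "q a = exp b"
  shows "((\<lambda>z. b + Ln (q z / exp b)) has_field_derivative q' / q a) (at a)"
proof -
  have "((\<lambda>z. q z / exp b) has_field_derivative q' / exp b) (at a)"
    by (rule DERIV_cdivide[OF q])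
  moreover have "(Ln has_field_derivative inverse 1) (at (q a / exp b))"
    using has_field_derivative_Ln[of 1] assms(2) by simp
  ultimately have "((\<lambda>z. Ln (q z / exp b)) has_field_derivative inverse 1 * (q' / exp b)) (at a)"
    by (rule DERIV_chain2[rotated])
  from DERIV_add[OF DERIV_const[of b] this] show ?thesis by (simp add: assms(2))
qed

text \<open>The one-variable inverse function theorem in the form used below: an open set \<open>W\<close> that \<open>f\<close> maps
  bijectively onto a full ball.\<close>

lemma holomorphic_local_section:
  assumes hol: "f holomorphic_on U" and "open U" "a \<in> U" and f': "deriv f a \<noteq> 0"
  obtains r \<rho> W where "0 < r" "a \<in> W" "open W" "W \<subseteq> U" "\<rho> holomorphic_on ball (f a) r"
    "\<And>w. w \<in> ball (f a) r \<Longrightarrow> \<rho> w \<in> W \<and> f (\<rho> w) = w"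
    "\<And>z. z \<in> W \<Longrightarrow> f z \<in> ball (f a) r \<and> \<rho> (f z) = z"
proof -
  obtain e where e: "0 < e" "ball a e \<subseteq> U" "inj_on f (ball a e)"
    using has_complex_derivative_locally_injective[OF hol \<open>a \<in> U\<close> \<open>open U\<close> f'] by blast
  have hol': "f holomorphic_on ball a e" using hol e holomorphic_on_subset by blast
  have op: "open (f ` ball a e)" using open_mapping_thm3[OF hol' _ e(3)] by simp
  obtain \<rho> where \<rho>: "\<rho> holomorphic_on (f ` ball a e)" "\<And>z. z \<in> ball a e \<Longrightarrow> \<rho> (f z) = z"
    by (rule holomorphic_has_inverse[OF hol' open_ball e(3)]) blast
  obtain r where r: "0 < r" "ball (f a) r \<subseteq> f ` ball a e"
  proof -
    have "f a \<in> f ` ball a e" using e(1) by simp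
    then show thesis using op that unfolding open_contains_ball by blast
  qed
  define W where "W = ball a e \<inter> f -` ball (f a) r"
  show thesis
  proof (rule that[of r W \<rho>])
    show "open W" unfolding W_def
      by (rule continuous_open_preimage[OF holomorphic_on_imp_continuous_on[OF hol'] open_ball open_ball])
    show "\<rho> w \<in> W \<and> f (\<rho> w) = w" if "w \<in> ball (f a) r" for w
      using that r \<rho> by (auto simp: W_def)
  qed (use e r \<rho> holomorphic_on_subset in \<open>auto simp: W_def\<close>)
qed

text \<open>The implicit function theorem for \<open>F\<close> near a simple zero.  In terms of the exponents
  \<open>a = - k1 x + k1\<^sup>3 t\<close> and \<open>b = - k2 x + k2\<^sup>3 t\<close> the zero set is locally the graph \<open>b = G a\<close> of a
  holomorphic function, and \<open>k1 b - k2 a\<close> is a constant multiple of \<open>t\<close>.  Thus \<open>t = \<tau> a\<close> on the zero set, and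
  inverting \<open>\<tau>\<close> yields \<open>a\<close>, and with it \<open>x\<close>, as a holomorphic function of \<open>t\<close>.  A simple
  zero is one where \<open>\<tau>\<close> has nonzero derivative.\<close>

lemma local_branch:
  assumes k: "0 < k1" "k1 < k2" and s: "s = 1 \<or> s = - 1"
    and zero: "F k1 k2 s x0 t0 = 0" and D: "\<not> double_zero k1 k2 s x0 t0"
  obtains r d \<phi> where "0 < r" "0 < d" "\<phi> holomorphic_on ball (of_real t0) r"
    "\<And>t. \<bar>t - t0\<bar> < r \<Longrightarrow> \<phi> (of_real t) \<in> ball x0 d \<and>
       (\<forall>x\<in>ball x0 d. F k1 k2 s x t = 0 \<longleftrightarrow> x = \<phi> (of_real t))"
proof -
  define g where "g = gam k1 k2"
  have g: "1 < g" using gam_gt_1[OF k] by (simp add: g_def)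
  define A where "A = (\<lambda>k x (t::real). - of_real k * x + of_real (k ^ 3 * t) :: complex)"
  have expf: "expf k x t = exp (A k x t)" for k x t by (simp add: expf_def A_def)
  define S :: complex where "S = of_int s"
  have S: "S * S = 1" using s by (auto simp: S_def)
  define z0 where "z0 = expf k1 x0 t0"
  define w0 where "w0 = expf k2 x0 t0"
  obtain \<sigma> where \<sigma>: "\<sigma> = 1 \<or> \<sigma> = (-1 :: complex)"
    and eq: "S * w0 * (z0 - \<i> * \<sigma> * of_real g) = 1 + \<i> * \<sigma> * of_real g * z0"
    using zero unfolding F_eq_P P_eq_0_iff S_def z0_def w0_def g_def by blast
  define c :: complex where "c = \<i> * \<sigma>"
  have c: "c * c = -1" "c \<noteq> 0" using \<sigma> by (auto simp: c_def)
  \<comment> \<open>The two factors of \<open>P g s z w\<close> are \<open>H c z w\<close> and \<open>H (- c) z w\<close>, up to sign; the first one vanishes at the given zero.\<close>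
  define H where "H = (\<lambda>c z w. S * w * (z - c * of_real g) - (1 + c * of_real g * z))"
  have P_H: "P g s z w = 0 \<longleftrightarrow> H c z w = 0 \<or> H (-c) z w = 0" for z w
    using \<sigma> by (auto simp: P_eq_0_iff H_def c_def S_def)
  have H0: "H c z0 w0 = 0" using eq by (simp add: H_def c_def)
  have gg: "of_real g * of_real g \<noteq> (1::complex)"
    using g less_1_mult[of g g] by (metis less_irrefl of_real_1 of_real_eq_iff of_real_mult)
  have nz: "z - c * of_real g \<noteq> 0" if "H c z w = 0" for z w
  proof
    assume "z - c * of_real g = 0"
    with that have "1 + c * of_real g * (c * of_real g) = 0" by (auto simp: H_def add_eq_0_iff)
    then have "(c * c) * (of_real g * of_real g) = -1" by (simp add: algebra_simps add_eq_0_iff)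
    then show False using gg by (simp add: c)
  qed
  have nzero: "z0 \<noteq> 0" "w0 \<noteq> 0" by (auto simp: z0_def w0_def)
  \<comment> \<open>On the zero set of \<open>H c\<close>, the value \<open>z = c\<close> forces \<open>w = - s c\<close>, the pair of values at a double zero.\<close>
  have z0c: "z0 \<noteq> c"
  proof
    assume z: "z0 = c"
    have "(of_real g - 1) * (c * (S * w0) - 1) = 0"
    proof -
      have "S * w0 * (c - c * of_real g) = 1 + (c * c) * of_real g"
        using H0 by (simp add: H_def z algebra_simps)
      then show ?thesis unfolding c by (simp add: algebra_simps)
    qed
    moreover have "of_real g \<noteq> (1 :: complex)" using g by (simp only: of_real_eq_1_iff)
    ultimately have "c * (S * w0) = 1" by simp
    then have "S * (c * c) * (S * w0) = S * c" by (metis mult.assoc mult.commute mult_1_right)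
    then have "- ((S * S) * w0) = S * c" unfolding c by (simp add: mult.assoc)
    then have "w0 = - S * c" by (metis S minus_minus mult_1 mult_minus_left)
    then show False
      using D z c by (simp add: double_zero_def z0_def w0_def S_def power2_eq_square)
  qed
  \<comment> \<open>Both factors vanish together only if both squares in \<open>F\<close> vanish, which again is a double zero.\<close>
  have other: "H (-c) z0 w0 \<noteq> 0"
  proof
    assume "H (-c) z0 w0 = 0"
    then have "H c z0 w0 + H (-c) z0 w0 = 0" "H (-c) z0 w0 - H c z0 w0 = 0" using H0 by auto
    then have 1: "S * w0 * z0 = 1" and "2 * c * of_real g * (S * w0 + z0) = 0"
      by (auto simp: H_def algebra_simps)
    then have "S * w0 + z0 = 0" using c g by auto
    then have 2: "z0 = - (S * w0)" by (simp add: add_eq_0_iff)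
    then have "w0 = - S * z0" using S by (metis (no_types, opaque_lifting) mult.assoc mult.left_neutral mult_minus_left mult_minus_right minus_minus)
    moreover have "z0\<^sup>2 = -1" using 1 2 by (metis minus_mult_minus minus_mult_left mult_minus_right power2_eq_square minus_minus)
    ultimately show False using D by (simp add: double_zero_def z0_def w0_def S_def)
  qed
  \<comment> \<open>The relation \<open>H c z w = 0\<close> solved for \<open>w\<close>, using that \<open>S\<close> is its own inverse.\<close>
  define Q where "Q = (\<lambda>z. S * (1 + c * of_real g * z) / (z - c * of_real g))"
  have H_Q: "H c z w = 0 \<longleftrightarrow> w = Q z" if "z - c * of_real g \<noteq> 0" for z w
  proof -
    have "H c z w = 0 \<longleftrightarrow> S * H c z w = 0" using S by auto
    also have "\<dots> \<longleftrightarrow> (S * S) * w * (z - c * of_real g) = S * (1 + c * of_real g * z)"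
      by (simp add: H_def algebra_simps)
    also have "\<dots> \<longleftrightarrow> w = Q z" using that by (simp add: S Q_def field_simps)
    finally show ?thesis .
  qed
  define a0 where "a0 = A k1 x0 t0"
  define b0 where "b0 = A k2 x0 t0"
  have z0w0: "z0 = exp a0" "w0 = exp b0" by (simp_all add: z0_def w0_def expf a0_def b0_def)
  have nz0: "z0 - c * of_real g \<noteq> 0" using nz H0 by blast
  have Q0: "Q z0 = w0" using H_Q[OF nz0] H0 by simp
  have num0: "1 + c * of_real g * z0 \<noteq> 0" using Q0 nzero by (auto simp: Q_def)
  \<comment> \<open>The set \<open>E\<close> keeps the argument of \<open>Ln\<close> in the right half plane, away from the branch cut.\<close>
  define G where "G = (\<lambda>a. b0 + Ln (Q (exp a) / exp b0))"
  define E where "E = {a. exp a - c * of_real g \<noteq> 0 \<and> Re (Q (exp a) / exp b0) > 0}"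
  define \<Delta> where "\<Delta> = k1 * k2 * (k2\<^sup>2 - k1\<^sup>2)"
  have \<Delta>: "\<Delta> \<noteq> 0" using k by (simp add: \<Delta>_def power2_eq_iff_nonneg)
  define \<tau> where "\<tau> = (\<lambda>a. (of_real k1 * G a - of_real k2 * a) / of_real \<Delta>)"
  have contQ: "continuous_on {a. exp a - c * of_real g \<noteq> 0} (\<lambda>a. Q (exp a) / exp b0)"
    by (auto simp: Q_def intro!: continuous_intros)
  have openE0: "open {a. exp a - c * of_real g \<noteq> 0}"
    by (intro open_Collect_neq continuous_intros)
  have openE: "open E"
  proof -
    have "E = {a. exp a - c * of_real g \<noteq> 0} \<inter> (\<lambda>a. Q (exp a) / exp b0) -` {z. Re z > 0}"
      by (auto simp: E_def)
    then show ?thesis using continuous_open_preimage[OF contQ openE0 open_halfspace_Re_gt] by simp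
  qed
  have a0E: "a0 \<in> E" using nz0 Q0 by (simp add: E_def flip: z0w0) (use nzero in simp)
  have derG: "(G has_field_derivative z0 * (of_real g * of_real g - 1) /
      ((z0 - c * of_real g) * (1 + c * of_real g * z0))) (at a0)"
  proof -
    have S0: "S \<noteq> 0" using S by auto
    have "((\<lambda>a. Q (exp a)) has_field_derivative
       (S * (c * of_real g * z0) * (z0 - c * of_real g) - S * (1 + c * of_real g * z0) * z0) /
        ((z0 - c * of_real g) * (z0 - c * of_real g))) (at a0)"
      unfolding Q_def using nz0 by (auto intro!: derivative_eq_intros simp: z0w0)
    moreover have "S * (c * of_real g * z0) * (z0 - c * of_real g) - S * (1 + c * of_real g * z0) * z0
        = S * z0 * (of_real g * of_real g - 1)" (is "?l = ?r")
    proof -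
      have "?l = S * z0 * (- (c * c) * (of_real g * of_real g) - 1)" by (simp add: algebra_simps)
      then show ?thesis unfolding c by simp
    qed
    ultimately have "((\<lambda>a. Q (exp a)) has_field_derivative
       (S * z0 * (of_real g * of_real g - 1)) /
        ((z0 - c * of_real g) * (z0 - c * of_real g))) (at a0)" by (simp only:)
    from has_field_derivative_local_log[OF this, of b0] Q0
    have "(G has_field_derivative (S * z0 * (of_real g * of_real g - 1)) /
        ((z0 - c * of_real g) * (z0 - c * of_real g)) / Q z0) (at a0)"
      by (simp add: G_def z0w0)
    moreover have "(S * z0 * (of_real g * of_real g - 1)) /
        ((z0 - c * of_real g) * (z0 - c * of_real g)) / Q z0 =
        z0 * (of_real g * of_real g - 1) / ((z0 - c * of_real g) * (1 + c * of_real g * z0))"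
      unfolding Q_def using nz0 num0 S0 by (simp add: divide_simps)
    ultimately show ?thesis by simp
  qed
  \<comment> \<open>By the value of \<open>g\<close>, the numerator of the derivative of \<open>\<tau>\<close> is a nonzero multiple of \<open>(z0 - c)\<^sup>2\<close>.\<close>
  have der: "deriv \<tau> a0 \<noteq> 0"
  proof
    have der\<tau>: "(\<tau> has_field_derivative (of_real k1 * (z0 * (of_real g * of_real g - 1) /
      ((z0 - c * of_real g) * (1 + c * of_real g * z0))) - of_real k2) / of_real \<Delta>) (at a0)"
      using DERIV_cdivide[OF DERIV_diff[OF DERIV_cmult[OF derG, of "of_real k1"]
            DERIV_cmult[OF DERIV_ident, of "of_real k2"]], of "of_real \<Delta>"]
      unfolding \<tau>_def by simp
    assume "deriv \<tau> a0 = 0"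
    with der\<tau> have "of_real k1 * (z0 * (of_real g * of_real g - 1) /
      ((z0 - c * of_real g) * (1 + c * of_real g * z0))) - of_real k2 = 0"
      using \<Delta> by (metis DERIV_imp_deriv divide_eq_0_iff of_real_eq_0_iff)
    then have *: "of_real k1 * (z0 * (of_real g * of_real g - 1)) =
       of_real k2 * ((z0 - c * of_real g) * (1 + c * of_real g * z0))"
      using nz0 num0 by (simp add: divide_simps)
    have kg: "k1 * (g * g - 1) - k2 * (g * g + 1) = - 2 * k2 * g"
    proof -
      have "(k2 - k1) * g = k2 + k1" using k by (simp add: g_def gam_def)
      then have g': "k1 * g + k1 = k2 * g - k2" by (simp add: algebra_simps)
      have "k1 * (g * g - 1) = (k1 * g + k1) * (g - 1)" by (simp add: algebra_simps)
      also have "\<dots> = k2 * (g * g + 1) - 2 * k2 * g" unfolding g' by (simp add: algebra_simps)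
      finally show ?thesis by simp
    qed
    have prod: "(z0 - c * of_real g) * (1 + c * of_real g * z0) =
       z0 * (1 + of_real g * of_real g) + c * of_real g * (z0 * z0 - 1)" (is "?l = ?r")
    proof -
      have "?l = z0 * (1 - (c * c) * (of_real g * of_real g)) + c * of_real g * (z0 * z0 - 1)"
        by (simp add: algebra_simps)
      then show ?thesis unfolding c by simp
    qed
    have "z0 * of_real (k1 * (g * g - 1) - k2 * (g * g + 1)) = of_real k2 * (c * of_real g * (z0 * z0 - 1))"
      using * unfolding prod by (simp add: algebra_simps)
    then have "z0 * of_real (- 2 * k2 * g) = of_real k2 * (c * of_real g * (z0 * z0 - 1))"
      unfolding kg .
    then have "of_real k2 * of_real g * (c * (z0 * z0 - 1) + 2 * z0) = 0"
      by (simp add: algebra_simps)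
    then have "c * (z0 * z0 - 1) + 2 * z0 = 0" using k g by simp
    moreover have "- c * (c * (z0 * z0 - 1) + 2 * z0) = - (c * c) * (z0 * z0 - 1) - 2 * c * z0"
      by (simp add: algebra_simps)
    then have "- c * (c * (z0 * z0 - 1) + 2 * z0) = (z0 * z0 - 1) - 2 * c * z0"
      unfolding c by simp
    moreover have "(z0 - c) * (z0 - c) = z0 * z0 + c * c - 2 * c * z0" by (simp add: algebra_simps)
    then have "(z0 - c) * (z0 - c) = (z0 * z0 - 1) - 2 * c * z0" unfolding c by simp
    ultimately have "(z0 - c) * (z0 - c) = 0" by simp
    then show False using z0c by simp
  qed
  have hol\<tau>: "\<tau> holomorphic_on E"
  proof -
    have "Q (exp a) / exp b0 \<notin> \<real>\<^sub>\<le>\<^sub>0" if "a \<in> E" for a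
      using that by (auto simp: E_def complex_nonpos_Reals_iff)
    then have "G holomorphic_on E" unfolding G_def
      by (intro holomorphic_intros) (auto simp: Q_def E_def intro!: holomorphic_intros)
    then show ?thesis unfolding \<tau>_def using \<Delta> by (intro holomorphic_intros) auto
  qed
  obtain r \<rho> W where r: "0 < r" "a0 \<in> W" "open W" "W \<subseteq> E"
    "\<rho> holomorphic_on ball (\<tau> a0) r"
    "\<And>w. w \<in> ball (\<tau> a0) r \<Longrightarrow> \<rho> w \<in> W \<and> \<tau> (\<rho> w) = w"
    "\<And>z. z \<in> W \<Longrightarrow> \<tau> z \<in> ball (\<tau> a0) r \<and> \<rho> (\<tau> z) = z"
    by (rule holomorphic_local_section[OF hol\<tau> openE a0E der]) blast
  \<comment> \<open>The change of coordinates from \<open>(x, t)\<close> to the two exponents.\<close>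
  have A_\<tau>: "of_real k1 * A k2 x t - of_real k2 * A k1 x t = of_real \<Delta> * of_real t" for x t
    by (simp add: A_def \<Delta>_def power2_eq_square power3_eq_cube algebra_simps)
  have expG: "exp (G a) = Q (exp a)" if "a \<in> E" for a
  proof -
    have "Q (exp a) / exp b0 \<noteq> 0" using that by (auto simp: E_def)
    then show ?thesis by (simp add: G_def exp_add exp_Ln)
  qed
  have G0: "G a0 = b0" by (simp add: G_def Q0 flip: z0w0) (use nzero in simp)
  have \<tau>0: "\<tau> a0 = of_real t0"
    using A_\<tau>[of x0 t0, folded a0_def b0_def] \<Delta> by (simp add: \<tau>_def G0)
  define \<phi> where "\<phi> = (\<lambda>t. (of_real (k1 ^ 3) * t - \<rho> t) / of_real k1)"
  have hol: "\<phi> holomorphic_on ball (of_real t0) r"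
    unfolding \<phi>_def using k r(5) \<tau>0 by (auto intro!: holomorphic_intros)
  have A_\<phi>: "A k1 (\<phi> (of_real t)) t = \<rho> (of_real t)" for t
    using k by (simp add: A_def \<phi>_def)
  have A_\<phi>2: "A k2 (\<phi> (of_real t)) t = G (\<rho> (of_real t))" if "\<bar>t - t0\<bar> < r" for t
  proof -
    have "of_real t \<in> ball (\<tau> a0) r" using that by (simp add: \<tau>0 dist_of_real dist_real_def abs_minus_commute)
    then have "\<tau> (\<rho> (of_real t)) = of_real t" using r(6) by blast
    then have "of_real k1 * G (\<rho> (of_real t)) - of_real k2 * \<rho> (of_real t) = of_real \<Delta> * of_real t"
      using \<Delta> by (simp add: \<tau>_def field_simps)
    then have "of_real k1 * A k2 (\<phi> (of_real t)) t = of_real k1 * G (\<rho> (of_real t))"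
      using A_\<tau>[of "\<phi> (of_real t)" t] A_\<phi>[of t] by (simp add: algebra_simps)
    then show ?thesis using k by simp
  qed
  have F_\<phi>: "F k1 k2 s (\<phi> (of_real t)) t = 0" if "\<bar>t - t0\<bar> < r" for t
  proof -
    have "of_real t \<in> ball (\<tau> a0) r" using that by (simp add: \<tau>0 dist_of_real dist_real_def abs_minus_commute)
    then have "\<rho> (of_real t) \<in> E" using r by blast
    then have "H c (exp (\<rho> (of_real t))) (exp (G (\<rho> (of_real t)))) = 0"
      using expG H_Q by (auto simp: E_def)
    then show ?thesis using P_H
      by (simp add: F_eq_P expf A_\<phi> A_\<phi>2[OF that] flip: g_def)
  qed
  have \<phi>0: "\<phi> (of_real t0) = x0"
  proof -
    have "\<rho> (of_real t0) = a0" using r(2,7) \<tau>0 by metis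
    then show ?thesis using k by (simp add: \<phi>_def a0_def A_def)
  qed
  \<comment> \<open>Near \<open>(x0, t0)\<close> the other factor is nonzero and both exponents are close to \<open>a0\<close> and \<open>b0\<close>, so that \<open>G\<close> selects the right logarithm.\<close>
  have "\<forall>\<^sub>F p in nhds (x0, t0). F k1 k2 s (fst p) (snd p) = 0 \<longrightarrow> fst p = \<phi> (of_real (snd p))"
  proof -
    have cA: "((\<lambda>p. A k (fst p) (snd p)) \<longlongrightarrow> A k x0 t0) (nhds (x0, t0))" for k
      unfolding A_def by (auto intro!: tendsto_eq_intros filterlim_ident)
    have "\<forall>\<^sub>F p in nhds (x0, t0). A k1 (fst p) (snd p) \<in> W"
      using topological_tendstoD[OF cA[of k1] r(3)] r(2) by (simp add: a0_def)
    moreover have "\<forall>\<^sub>F p in nhds (x0, t0). H (-c) (expf k1 (fst p) (snd p)) (expf k2 (fst p) (snd p)) \<noteq> 0"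
    proof (rule tendsto_imp_eventually_ne)
      show "((\<lambda>p. H (-c) (expf k1 (fst p) (snd p)) (expf k2 (fst p) (snd p))) \<longlongrightarrow> H (-c) z0 w0) (nhds (x0, t0))"
        unfolding H_def expf z0_def w0_def by (intro tendsto_intros cA)
    qed (rule other)
    moreover have "\<forall>\<^sub>F p in nhds (x0, t0). norm (A k2 (fst p) (snd p) - b0) < pi / 2"
      using tendstoD[OF cA[of k2], of "pi / 2"] by (simp add: b0_def dist_norm)
    ultimately show ?thesis
    proof eventually_elim
      case (elim p)
      obtain x t where p: "p = (x, t)" by (cases p)
      let ?a = "A k1 x t" and ?b = "A k2 x t"
      show ?case
      proof
        assume "F k1 k2 s (fst p) (snd p) = 0"
        then have "H c (exp ?a) (exp ?b) = 0"
          using elim P_H by (simp add: F_eq_P expf p flip: g_def)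
        moreover have aW: "?a \<in> W" and aE: "?a \<in> E" using elim r by (auto simp: p)
        ultimately have bQ: "exp ?b = Q (exp ?a)" using H_Q by (auto simp: E_def)
        have "\<bar>Im (?b - b0)\<bar> < pi / 2" using elim(3) abs_Im_le_cmod[of "?b - b0"] by (simp add: p)
        then have "- pi < Im (?b - b0)" "Im (?b - b0) \<le> pi"
          using pi_gt_zero by linarith+
        then have "G ?a = ?b"
          unfolding G_def bQ[symmetric] exp_diff[symmetric]
          by (subst Ln_exp) auto
        then have "\<tau> ?a = of_real t" using A_\<tau>[of x t] \<Delta> by (simp add: \<tau>_def)
        then have "\<rho> (of_real t) = ?a" using r(7)[OF aW] by simp
        then show "fst p = \<phi> (of_real (snd p))" using k by (simp add: \<phi>_def p A_def)
      qed
    qed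
  qed
  then obtain e where e: "0 < e"
    "\<And>x t. dist (x, t) (x0, t0) < e \<Longrightarrow> F k1 k2 s x t = 0 \<Longrightarrow> x = \<phi> (of_real t)"
    unfolding eventually_nhds_metric by force
  have "continuous_on (ball t0 r) (\<lambda>t. \<phi> (of_real t))"
    by (rule continuous_on_compose2[OF holomorphic_on_imp_continuous_on[OF hol]])
       (auto intro!: continuous_intros simp: dist_of_real)
  then have "isCont (\<lambda>t. \<phi> (of_real t)) t0"
    using r(1) by (simp add: continuous_on_eq_continuous_at)
  then obtain r' where r': "0 < r'" "\<And>t. dist t t0 < r' \<Longrightarrow> dist (\<phi> (of_real t)) x0 < e / 2"
    using e(1) \<phi>0 unfolding continuous_at_eps_delta by (metis half_gt_zero)
  show thesis
  proof (rule that[of "min r (min r' (e / 2))" "e / 2" \<phi>])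
    show "0 < min r (min r' (e / 2))" "0 < e / 2" using r r' e by auto
    show "\<phi> holomorphic_on ball (of_real t0) (min r (min r' (e / 2)))"
      using hol by (rule holomorphic_on_subset) auto
    fix t assume t: "\<bar>t - t0\<bar> < min r (min r' (e / 2))"
    have "\<phi> (of_real t) \<in> ball x0 (e / 2)"
      using r'(2)[of t] t by (simp add: dist_real_def dist_commute)
    moreover have "x = \<phi> (of_real t)" if "x \<in> ball x0 (e / 2)" "F k1 k2 s x t = 0" for x
    proof (rule e(2)[OF _ that(2)])
      have "dist (x, t) (x0, t0) \<le> dist x x0 + dist t t0"
        unfolding dist_Pair_Pair by (rule sqrt_sum_squares_le_sum) auto
      also have "\<dots> < e / 2 + e / 2"
        using that t by (intro add_strict_mono) (auto simp: dist_commute dist_real_def abs_minus_commute)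
      finally show "dist (x, t) (x0, t0) < e" by simp
    qed
    moreover have "F k1 k2 s (\<phi> (of_real t)) t = 0" using F_\<phi> t by simp
    ultimately show "\<phi> (of_real t) \<in> ball x0 (e / 2) \<and>
       (\<forall>x\<in>ball x0 (e / 2). F k1 k2 s x t = 0 \<longleftrightarrow> x = \<phi> (of_real t))"
      by metis
  qed
qed

section \<open>Continuation of sections of a set-valued map\<close>

text \<open>The total space \<open>{(t, x). x \<in> Z t}\<close> is, near \<open>(t0, x0)\<close>, the graph of a continuous function of \<open>t\<close>: the
  projection to \<open>t\<close> is a local homeomorphism there.\<close>

definition local_graph :: "(real \<Rightarrow> 'a::metric_space set) \<Rightarrow> real \<Rightarrow> 'a \<Rightarrow> bool" where
  "local_graph Z t0 x0 \<longleftrightarrow>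
     (\<exists>r>0. \<exists>d>0. \<exists>\<phi>. continuous_on (ball t0 r) \<phi> \<and>
        (\<forall>t\<in>ball t0 r. \<phi> t \<in> ball x0 d \<and> (\<forall>x\<in>ball x0 d. x \<in> Z t \<longleftrightarrow> x = \<phi> t)))"

definition section_on :: "(real \<Rightarrow> 'a::metric_space set) \<Rightarrow> real set \<Rightarrow> (real \<Rightarrow> 'a) \<Rightarrow> bool" where
  "section_on Z I x \<longleftrightarrow> continuous_on I x \<and> (\<forall>t\<in>I. x t \<in> Z t)"

lemma section_on_subset: "section_on Z I x \<Longrightarrow> J \<subseteq> I \<Longrightarrow> section_on Z J x"
  unfolding section_on_def by (blast intro: continuous_on_subset)

text \<open>The set where two sections agree is closed by continuity and open by the local graph property.\<close>

lemma section_unique: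
  fixes x y :: "real \<Rightarrow> 'a::metric_space"
  assumes loc: "\<And>t x. t \<in> J \<Longrightarrow> x \<in> Z t \<Longrightarrow> local_graph Z t x"
    and J: "connected J" and x: "section_on Z J x" and y: "section_on Z J y"
    and t0: "t0 \<in> J" "x t0 = y t0" and t: "t \<in> J"
  shows "x t = y t"
proof -
  define A where "A = {t \<in> J. x t = y t}"
  have "closedin (top_of_set J) {t \<in> J. dist (x t) (y t) = 0}"
    using x y by (intro continuous_closedin_preimage_constant continuous_intros) (auto simp: section_on_def)
  then have "closedin (top_of_set J) A" by (simp add: A_def)
  moreover have "openin (top_of_set J) A"
  proof (subst openin_euclidean_subtopology_iff, intro conjI ballI)
    show "A \<subseteq> J" by (auto simp: A_def)
    fix u assume u: "u \<in> A"
    then have uJ: "u \<in> J" and uxy: "x u = y u" by (auto simp: A_def)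
    obtain r d \<phi> where rd: "0 < r" "0 < d"
      and \<phi>: "\<And>t x'. t \<in> ball u r \<Longrightarrow> x' \<in> ball (x u) d \<Longrightarrow> x' \<in> Z t \<longleftrightarrow> x' = \<phi> t"
      using loc[OF uJ, of "x u"] uJ x unfolding section_on_def local_graph_def by metis
    obtain r1 where r1: "0 < r1" "\<And>v. v \<in> J \<Longrightarrow> dist v u < r1 \<Longrightarrow> dist (x v) (x u) < d"
      using x uJ rd(2) unfolding section_on_def continuous_on_iff by blast
    obtain r2 where r2: "0 < r2" "\<And>v. v \<in> J \<Longrightarrow> dist v u < r2 \<Longrightarrow> dist (y v) (y u) < d"
      using y uJ rd(2) unfolding section_on_def continuous_on_iff by blast
    show "\<exists>e>0. \<forall>v\<in>J. dist v u < e \<longrightarrow> v \<in> A"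
    proof (intro exI[of _ "min r (min r1 r2)"] conjI ballI impI)
      show "0 < min r (min r1 r2)" using rd r1 r2 by auto
      fix v assume v: "v \<in> J" "dist v u < min r (min r1 r2)"
      have "x v = \<phi> v" "y v = \<phi> v"
        using \<phi>[of v "x v"] \<phi>[of v "y v"] r1(2)[OF v(1)] r2(2)[OF v(1)] v x y uxy
        by (auto simp: section_on_def dist_commute)
      then show "v \<in> A" using v by (simp add: A_def)
    qed
  qed
  ultimately have "A = J"
    using J t0 unfolding connected_clopen A_def by blast
  then show ?thesis using t by (auto simp: A_def)
qed

text \<open>The supremum \<open>T\<close> of the times that a section through \<open>x0\<close> reaches is attained and equals \<open>b\<close>: by
  compactness the endpoints of sections over \<open>{a..\<tau> n}\<close> with \<open>\<tau> n \<longlonglongrightarrow> T\<close> accumulate at a point over \<open>T\<close>, and a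
  section that comes close enough to that point lies on the local graph through it, which leads beyond
  \<open>T\<close>.\<close>

lemma section_extends_right:
  fixes Z :: "real \<Rightarrow> 'a::metric_space set"
  assumes loc: "\<And>t x. t \<in> {a..b} \<Longrightarrow> x \<in> Z t \<Longrightarrow> local_graph Z t x"
    and comp: "compact {(t, x). t \<in> {a..b} \<and> x \<in> Z t}"
    and ab: "a \<le> b" and x0: "x0 \<in> Z a"
  obtains x where "section_on Z {a..b} x" "x a = x0"
proof -
  define S where "S = {T \<in> {a..b}. \<exists>x. section_on Z {a..T} x \<and> x a = x0}"
  have "a \<in> S" using ab x0 by (auto simp: S_def section_on_def intro!: exI[of _ "\<lambda>_. x0"])
  have bdd: "bdd_above S" by (rule bdd_aboveI[of _ b]) (auto simp: S_def)
  define T where "T = Sup S"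
  have "T \<in> closure S" using closure_contains_Sup bdd \<open>a \<in> S\<close> by (auto simp: T_def)
  then obtain \<tau> where \<tau>: "\<And>n. \<tau> n \<in> S" "\<tau> \<longlonglongrightarrow> T"
    unfolding closure_sequential by blast
  have "\<forall>n. \<exists>x. section_on Z {a..\<tau> n} x \<and> x a = x0"
    using \<tau>(1) by (auto simp: S_def)
  then obtain \<xi> where \<xi>: "section_on Z {a..\<tau> n} (\<xi> n) \<and> \<xi> n a = x0" for n
    by metis
  have \<tau>ab: "a \<le> \<tau> n" "\<tau> n \<le> b" "\<tau> n \<le> T" for n
    using \<tau>(1)[of n] cSup_upper[OF _ bdd] by (auto simp: S_def T_def)
  have K: "(\<tau> n, \<xi> n (\<tau> n)) \<in> {(t, x). t \<in> {a..b} \<and> x \<in> Z t}" for n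
    using \<xi>[of n] \<tau>ab[of n] by (auto simp: section_on_def)
  obtain l r where l: "l \<in> {(t, x). t \<in> {a..b} \<and> x \<in> Z t}" "strict_mono r"
    "((\<lambda>n. (\<tau> n, \<xi> n (\<tau> n))) \<circ> r) \<longlonglongrightarrow> l"
    using comp[unfolded compact_def, rule_format, of "\<lambda>n. (\<tau> n, \<xi> n (\<tau> n))", OF K] by blast
  obtain T' x' where Tx: "l = (T', x')" by (cases l)
  have "(\<tau> \<circ> r) \<longlonglongrightarrow> T'" and lim: "(\<lambda>n. \<xi> (r n) (\<tau> (r n))) \<longlonglongrightarrow> x'"
    using tendsto_fst[OF l(3)] tendsto_snd[OF l(3)] by (simp_all add: Tx o_def)
  moreover have lim\<tau>: "(\<tau> \<circ> r) \<longlonglongrightarrow> T" using LIMSEQ_subseq_LIMSEQ[OF \<tau>(2) l(2)] .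
  ultimately have "T' = T" using LIMSEQ_unique by blast
  then have Tab: "T \<in> {a..b}" "x' \<in> Z T" using l(1) by (auto simp: Tx)
  then obtain e d \<phi> where ed: "0 < e" "0 < d" and cont: "continuous_on (ball T e) \<phi>"
    and \<phi>: "\<And>t. t \<in> ball T e \<Longrightarrow> \<phi> t \<in> ball x' d"
      "\<And>t x. t \<in> ball T e \<Longrightarrow> x \<in> ball x' d \<Longrightarrow> x \<in> Z t \<longleftrightarrow> x = \<phi> t"
    using loc[of T x'] unfolding local_graph_def by metis
  have "\<forall>\<^sub>F n in sequentially. dist ((\<tau> \<circ> r) n) T < e \<and> dist (\<xi> (r n) (\<tau> (r n))) x' < d"
    using tendstoD[OF lim\<tau> ed(1)] tendstoD[OF lim ed(2)] by (rule eventually_conj)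
  then obtain n where n: "dist (\<tau> (r n)) T < e" "dist (\<xi> (r n) (\<tau> (r n))) x' < d"
    unfolding eventually_sequentially by auto
  define u where "u = \<tau> (r n)"
  define y where "y = \<xi> (r n)"
  have u: "a \<le> u" "u \<le> b" "u \<le> T" "u \<in> ball T e" using \<tau>ab n by (auto simp: u_def dist_commute)
  have y: "section_on Z {a..u} y" "y a = x0" using \<xi> by (auto simp: y_def u_def)
  have "y u \<in> ball x' d" using n by (simp add: y_def u_def dist_commute)
  moreover have "y u \<in> Z u" using y(1) u(1) by (auto simp: section_on_def)
  ultimately have yu: "y u = \<phi> u" using \<phi>(2)[OF u(4)] by blast
  \<comment> \<open>The section \<open>y\<close> is glued at time \<open>u\<close> to the local graph, which reaches \<open>T1\<close>.\<close>
  define T1 where "T1 = min b (T + e / 2)"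
  have T1: "T \<le> T1" using Tab ed by (auto simp: T1_def)
  have sub: "{u..T1} \<subseteq> ball T e"
    using u(4) ed by (auto simp: T1_def dist_real_def abs_less_iff)
  have cl: "{a..T1} = {a..u} \<union> {u..T1}" using u T1 by auto
  have "section_on Z {a..T1} (\<lambda>t. if t \<le> u then y t else \<phi> t)"
    unfolding section_on_def
  proof
    show "continuous_on {a..T1} (\<lambda>t. if t \<le> u then y t else \<phi> t)"
      unfolding cl using y(1) continuous_on_subset[OF cont sub] yu
      by (intro continuous_on_cases) (auto simp: section_on_def)
    show "\<forall>t\<in>{a..T1}. (if t \<le> u then y t else \<phi> t) \<in> Z t"
    proof
      fix t assume "t \<in> {a..T1}"
      then show "(if t \<le> u then y t else \<phi> t) \<in> Z t"
        using y(1) \<phi>[of t] sub by (auto simp: section_on_def subset_iff)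
    qed
  qed
  then have T1x: "\<exists>x. section_on Z {a..T1} x \<and> x a = x0" using y(2) u(1) by force
  moreover have "T1 \<in> {a..b}" using u T1 by (auto simp: T1_def)
  ultimately have "T1 \<in> S" by (simp add: S_def)
  then have "T1 \<le> T" using cSup_upper[OF _ bdd] by (simp add: T_def)
  then have "T1 = b" using ed by (auto simp: T1_def)
  then show ?thesis using T1x that by blast
qed

lemma local_graph_reflect:
  assumes "local_graph Z (- t) x"
  shows "local_graph (\<lambda>t. Z (- t)) t x"
proof -
  obtain r d \<phi> where rd: "0 < r" "0 < d" and cont: "continuous_on (ball (- t) r) \<phi>"
    and \<phi>: "\<forall>t'\<in>ball (- t) r. \<phi> t' \<in> ball x d \<and> (\<forall>x'\<in>ball x d. x' \<in> Z t' \<longleftrightarrow> x' = \<phi> t')"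
    using assms unfolding local_graph_def by (elim exE conjE) (rule that)
  have m: "- t' \<in> ball (- t) r" if "t' \<in> ball t r" for t'
    using that by (simp add: dist_real_def abs_minus_commute)
  have "continuous_on (ball t r) (\<lambda>t. \<phi> (- t))"
    by (rule continuous_on_compose2[OF cont]) (auto intro!: continuous_intros simp: m simp del: mem_ball)
  moreover have "\<forall>t'\<in>ball t r. \<phi> (- t') \<in> ball x d \<and> (\<forall>x'\<in>ball x d. x' \<in> Z (- t') \<longleftrightarrow> x' = \<phi> (- t'))"
    using \<phi> m by blast
  ultimately show ?thesis
    unfolding local_graph_def using rd by blast
qed

lemma section_extends_left:
  fixes Z :: "real \<Rightarrow> 'a::metric_space set"
  assumes loc: "\<And>t x. t \<in> {a..b} \<Longrightarrow> x \<in> Z t \<Longrightarrow> local_graph Z t x"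
    and comp: "compact {(t, x). t \<in> {a..b} \<and> x \<in> Z t}"
    and ab: "a \<le> b" and x0: "x0 \<in> Z b"
  obtains x where "section_on Z {a..b} x" "x b = x0"
proof -
  have "compact ((\<lambda>(t, x). (- t, x)) ` {(t, x). t \<in> {a..b} \<and> x \<in> Z t})"
    by (rule compact_continuous_image[OF _ comp]) (auto simp: case_prod_beta intro!: continuous_intros)
  also have "(\<lambda>(t, x). (- t, x)) ` {(t, x). t \<in> {a..b} \<and> x \<in> Z t} = {(t, x). t \<in> {-b..-a} \<and> x \<in> Z (- t)}"
    by (auto simp: image_iff) (metis add.inverse_inverse neg_le_iff_le)
  finally have c: "compact {(t, x). t \<in> {-b..-a} \<and> x \<in> Z (- t)}" .
  obtain x where x: "section_on (\<lambda>t. Z (- t)) {-b..-a} x" "x (-b) = x0"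
  proof (rule section_extends_right[of "-b" "-a" "\<lambda>t. Z (- t)" x0])
    show "local_graph (\<lambda>t. Z (- t)) t x" if "t \<in> {-b..-a}" "x \<in> Z (- t)" for t x
      by (rule local_graph_reflect, rule loc) (use that in auto)
  qed (use ab x0 c in \<open>auto simp del: atLeastAtMost_iff\<close>)
  have "continuous_on {a..b} (\<lambda>t. x (- t))"
    by (rule continuous_on_compose2[of "{-b..-a}" x]) (use x in \<open>auto simp: section_on_def intro!: continuous_intros\<close>)
  moreover have "x (- t) \<in> Z t" if "t \<in> {a..b}" for t
    using x(1) that by (auto simp: section_on_def dest!: bspec[of _ _ "- t"])
  ultimately have "section_on Z {a..b} (\<lambda>t. x (- t))"
    by (simp add: section_on_def)
  then show ?thesis using that x(2) by blast
qed

lemma section_extends_interval: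
  fixes Z :: "real \<Rightarrow> 'a::metric_space set"
  assumes loc: "\<And>t x. t \<in> {a..b} \<Longrightarrow> x \<in> Z t \<Longrightarrow> local_graph Z t x"
    and comp: "\<And>c d. a \<le> c \<Longrightarrow> d \<le> b \<Longrightarrow> compact {(t, x). t \<in> {c..d} \<and> x \<in> Z t}"
    and t0: "t0 \<in> {a..b}" and x0: "x0 \<in> Z t0"
  obtains x where "section_on Z {a..b} x" "x t0 = x0"
proof -
  obtain x where x: "section_on Z {a..t0} x" "x t0 = x0"
  proof (rule section_extends_left[of a t0 Z x0])
    show "local_graph Z t x" if "t \<in> {a..t0}" "x \<in> Z t" for t x
      using that t0 by (intro loc) auto
    show "compact {(t, x). t \<in> {a..t0} \<and> x \<in> Z t}"
      using t0 by (intro comp) auto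
  qed (use t0 x0 in auto)
  obtain y where y: "section_on Z {t0..b} y" "y t0 = x0"
  proof (rule section_extends_right[of t0 b Z x0])
    show "local_graph Z t x" if "t \<in> {t0..b}" "x \<in> Z t" for t x
      using that t0 by (intro loc) auto
    show "compact {(t, x). t \<in> {t0..b} \<and> x \<in> Z t}"
      using t0 by (intro comp) auto
  qed (use t0 x0 in auto)
  have cl: "{a..b} = {a..t0} \<union> {t0..b}" using t0 by auto
  have "continuous_on {a..b} (\<lambda>t. if t \<le> t0 then x t else y t)"
    unfolding cl using x y by (intro continuous_on_cases) (auto simp: section_on_def)
  then have "section_on Z {a..b} (\<lambda>t. if t \<le> t0 then x t else y t)"
    using x y t0 by (auto simp: section_on_def)
  then show thesis using that x(2) by force
qed

text \<open>Path lifting for a local homeomorphism that is proper over compact intervals.  The value at \<open>t\<close> of the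
  global section is read off from a section over the interval between \<open>t0\<close> and \<open>t\<close>; by uniqueness these
  choices fit together.\<close>

lemma section_extends:
  fixes Z :: "real \<Rightarrow> 'a::metric_space set"
  assumes I: "open I" "is_interval I"
    and loc: "\<And>t x. t \<in> I \<Longrightarrow> x \<in> Z t \<Longrightarrow> local_graph Z t x"
    and comp: "\<And>a b. {a..b} \<subseteq> I \<Longrightarrow> compact {(t, x). t \<in> {a..b} \<and> x \<in> Z t}"
    and t0: "t0 \<in> I" and x0: "x0 \<in> Z t0"
  obtains x where "section_on Z I x" "x t0 = x0"
proof -
  have sub: "{a..b} \<subseteq> I" if "a \<in> I" "b \<in> I" for a b
    using I(2) that unfolding is_interval_1 by (meson atLeastAtMost_iff subsetI)
  have ex: "\<exists>x. section_on Z {a..b} x \<and> x t0 = x0" if "a \<in> I" "b \<in> I" "t0 \<in> {a..b}" for a b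
  proof -
    obtain x where "section_on Z {a..b} x" "x t0 = x0"
    proof (rule section_extends_interval[of a b Z t0 x0])
      show "compact {(t, x). t \<in> {c..d} \<and> x \<in> Z t}" if "a \<le> c" "d \<le> b" for c d
      proof (rule comp)
        have "{c..d} \<subseteq> {a..b}" using that by auto
        then show "{c..d} \<subseteq> I" using sub[OF \<open>a \<in> I\<close> \<open>b \<in> I\<close>] by blast
      qed
      show "local_graph Z t x" if "t \<in> {a..b}" "x \<in> Z t" for t x
        using that sub[OF \<open>a \<in> I\<close> \<open>b \<in> I\<close>] by (intro loc) auto
    qed (use \<open>t0 \<in> {a..b}\<close> x0 in auto)
    then show ?thesis by blast
  qed
  have "\<forall>t\<in>I. \<exists>x. section_on Z {min t t0..max t t0} x \<and> x t0 = x0"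
    using ex t0 by (simp add: min_def max_def)
  then obtain X where X: "section_on Z {min t t0..max t t0} (X t) \<and> X t t0 = x0" if "t \<in> I" for t
    by metis
  define x where "x t = X t t" for t
  have eq: "x t = y t" if y: "section_on Z {a..b} y" "y t0 = x0" and ab: "a \<in> I" "b \<in> I" "t0 \<in> {a..b}" and t: "t \<in> {a..b}"
    for y a b t
  proof -
    have tI: "t \<in> I" using sub ab t by blast
    have "X t t = y t"
    proof (rule section_unique[of "{min t t0..max t t0}" Z "X t" y t0 t])
      show "section_on Z {min t t0..max t t0} y"
        by (rule section_on_subset[OF y(1)]) (use ab t in auto)
      show "local_graph Z t' x'" if "t' \<in> {min t t0..max t t0}" "x' \<in> Z t'" for t' x'
        using that sub[OF ab(1,2)] ab t by (intro loc) (auto simp: subset_iff min_def max_def split: if_splits)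
    qed (use X[OF tI] y in auto)
    then show ?thesis by (simp add: x_def)
  qed
  have loc_x: "isCont x t \<and> x t \<in> Z t" if t: "t \<in> I" for t
  proof -
    obtain e where e: "0 < e" "cball t e \<subseteq> I" using I(1) t open_contains_cball by blast
    define a where "a = min t0 (t - e)"
    define b where "b = max t0 (t + e)"
    have ab: "a \<in> I" "b \<in> I" "t0 \<in> {a..b}"
      using e t0 by (auto simp: a_def b_def min_def max_def subset_iff dist_real_def)
    obtain y where y: "section_on Z {a..b} y" "y t0 = x0" using ex[OF ab] by blast
    have ev: "x u = y u" if "u \<in> {t - e<..<t + e}" for u
      by (rule eq[OF y ab]) (use that in \<open>auto simp: a_def b_def\<close>)
    have "continuous_on {t - e<..<t + e} y"
      by (rule continuous_on_subset[of "{a..b}"]) (use y in \<open>auto simp: section_on_def a_def b_def\<close>)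
    then have "continuous_on {t - e<..<t + e} x"
      by (subst continuous_on_cong[OF refl ev]) auto
    then have "isCont x t" using e(1) by (simp add: continuous_on_eq_continuous_at)
    moreover have "y t \<in> Z t" using y(1) e(1) by (auto simp: section_on_def a_def b_def dest!: bspec[of _ _ t])
    ultimately show ?thesis using ev[of t] e(1) by simp
  qed
  have "section_on Z I x"
    using loc_x I(1) by (simp add: section_on_def continuous_on_eq_continuous_at)
  moreover have "x t0 = x0" using eq[of t0 t0 "X t0" t0] X[OF t0] t0 by simp
  ultimately show thesis using that by blast
qed

text \<open>Restricting to an open set of points allows one to work between two barriers.\<close>

lemma local_graph_Int_open:
  assumes lg: "local_graph Z t0 x0" and x0: "x0 \<in> Z t0" and U: "open U" "x0 \<in> U"
  shows "local_graph (\<lambda>t. Z t \<inter> U) t0 x0"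
proof -
  obtain r d \<phi> where rd: "0 < r" "0 < d" and cont: "continuous_on (ball t0 r) \<phi>"
    and \<phi>: "\<forall>t\<in>ball t0 r. \<phi> t \<in> ball x0 d \<and> (\<forall>x\<in>ball x0 d. x \<in> Z t \<longleftrightarrow> x = \<phi> t)"
    using lg unfolding local_graph_def by (elim exE conjE) (rule that)
  obtain e where e: "0 < e" "ball x0 e \<subseteq> U" using U unfolding open_contains_ball by blast
  have \<phi>0: "\<phi> t0 = x0" using \<phi> rd x0 by (metis centre_in_ball)
  have "isCont \<phi> t0" using cont rd by (simp add: continuous_on_eq_continuous_at)
  moreover have "0 < min d e" using rd e by simp
  ultimately obtain r' where r': "0 < r'" "\<And>t. dist t t0 < r' \<Longrightarrow> dist (\<phi> t) x0 < min d e"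
    using \<phi>0 unfolding continuous_at_eps_delta by metis
  have "continuous_on (ball t0 (min r r')) \<phi>" by (rule continuous_on_subset[OF cont]) auto
  moreover have "\<forall>t\<in>ball t0 (min r r'). \<phi> t \<in> ball x0 (min d e) \<and>
      (\<forall>x\<in>ball x0 (min d e). x \<in> Z t \<inter> U \<longleftrightarrow> x = \<phi> t)"
  proof
    fix t assume t: "t \<in> ball t0 (min r r')"
    have "\<phi> t \<in> ball x0 (min d e)" using r'(2)[of t] t by (simp add: dist_commute)
    moreover have "x \<in> Z t \<inter> U \<longleftrightarrow> x = \<phi> t" if x: "x \<in> ball x0 (min d e)" for x
    proof -
      have "x \<in> U" "x \<in> ball x0 d" "t \<in> ball t0 r" using x e t by auto
      then show ?thesis using \<phi> by blast
    qed
    ultimately show "\<phi> t \<in> ball x0 (min d e) \<and> (\<forall>x\<in>ball x0 (min d e). x \<in> Z t \<inter> U \<longleftrightarrow> x = \<phi> t)"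
      by blast
  qed
  ultimately show ?thesis unfolding local_graph_def using rd r' e
    by (intro exI[of _ "min r r'"] exI[of _ "min d e"] exI[of _ \<phi>] conjI) auto
qed

section \<open>Curves of zeros\<close>

definition zeros :: "real \<Rightarrow> real \<Rightarrow> int \<Rightarrow> real \<Rightarrow> complex set" where
  "zeros k1 k2 s t = {x. F k1 k2 s x t = 0}"

lemma local_graph_zeros:
  assumes k: "0 < k1" "k1 < k2" and s: "s = 1 \<or> s = - 1"
    and x: "x \<in> zeros k1 k2 s t" and D: "\<not> double_zero k1 k2 s x t"
  shows "local_graph (zeros k1 k2 s) t x"
proof -
  have "F k1 k2 s x t = 0" using x by (simp add: zeros_def)
  then obtain r d \<phi> where rd: "0 < r" "0 < d" and hol: "\<phi> holomorphic_on ball (of_real t) r"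
    and \<phi>: "\<And>u. \<bar>u - t\<bar> < r \<Longrightarrow> \<phi> (of_real u) \<in> ball x d \<and>
       (\<forall>x\<in>ball x d. F k1 k2 s x u = 0 \<longleftrightarrow> x = \<phi> (of_real u))"
    by (rule local_branch[OF k s _ D]) blast
  have "continuous_on (ball t r) (\<lambda>u. \<phi> (of_real u))"
    by (rule continuous_on_compose2[OF holomorphic_on_imp_continuous_on[OF hol]])
       (auto intro!: continuous_intros simp: dist_of_real)
  moreover have "\<forall>u\<in>ball t r. \<phi> (of_real u) \<in> ball x d \<and>
      (\<forall>x\<in>ball x d. x \<in> zeros k1 k2 s u \<longleftrightarrow> x = \<phi> (of_real u))"
    using \<phi> by (simp add: zeros_def dist_real_def abs_minus_commute)
  ultimately show ?thesis
    unfolding local_graph_def using rd by (intro exI[of _ r] exI[of _ d] exI conjI)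
qed

lemma continuous_on_F:
  assumes "continuous_on A f" "continuous_on A g"
  shows "continuous_on A (\<lambda>p. F k1 k2 s (f p) (g p))"
  unfolding F_def expf_def by (intro continuous_intros assms)

text \<open>Since the barriers carry no zeros, the strict inequalities may be replaced by weak ones; the remaining
  conditions are closed, and the real parts are bounded.\<close>

lemma compact_zeros_between_barriers:
  assumes k: "0 < k1" "k1 < k2" and s: "s = 1 \<or> s = - 1"
    and y0: "cos (k2 * y0) = 0" "cos (k1 * y0) \<noteq> 0"
    and y1: "cos (k2 * y1) = 0" "cos (k1 * y1) \<noteq> 0"
  shows "compact {(t, x). t \<in> {a..b} \<and> x \<in> zeros k1 k2 s t \<inter> {x. y0 < Im x \<and> Im x < y1}}"
proof -
  obtain R where R: "\<And>x t. \<bar>t\<bar> \<le> max \<bar>a\<bar> \<bar>b\<bar> \<Longrightarrow> F k1 k2 s x t = 0 \<Longrightarrow> \<bar>Re x\<bar> < R"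
    using zeros_Re_bounded[OF k s] by metis
  have "compact (({a..b} \<times> cbox (Complex (- R) y0) (Complex R y1)) \<inter> {p. F k1 k2 s (snd p) (fst p) = 0})"
    by (intro compact_Int_closed compact_Times compact_Icc compact_cbox closed_Collect_eq continuous_on_F
        continuous_intros)
  also have "({a..b} \<times> cbox (Complex (- R) y0) (Complex R y1)) \<inter> {p. F k1 k2 s (snd p) (fst p) = 0} =
      {(t, x). t \<in> {a..b} \<and> x \<in> zeros k1 k2 s t \<inter> {x. y0 < Im x \<and> Im x < y1}}" (is "?l = ?r")
  proof (intro set_eqI)
    fix p :: "real \<times> complex"
    obtain t x where p: "p = (t, x)" by (cases p)
    have "\<bar>Re x\<bar> < R" if "F k1 k2 s x t = 0" "t \<in> {a..b}"
      using R[of t x] that by auto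
    moreover have "Im x \<noteq> y0" "Im x \<noteq> y1" if "F k1 k2 s x t = 0"
      using no_zero_on_barrier[OF k s, of x t] that y0 y1 by auto
    ultimately show "p \<in> ?l \<longleftrightarrow> p \<in> ?r"
      by (auto simp: p zeros_def in_cbox_complex_iff)
  qed
  finally show ?thesis .
qed

text \<open>Existence of the global curve: two barriers enclose the zero, and between them \<open>section_extends\<close> applies.\<close>

lemma curve_through_zero:
  assumes k: "0 < k1" "k1 < k2" and s: "s = 1 \<or> s = - 1"
    and I: "open I" "is_interval I"
    and D: "\<And>t x. t \<in> I \<Longrightarrow> \<not> double_zero k1 k2 s x t"
    and t0: "t0 \<in> I" and x0: "x0 \<in> zeros k1 k2 s t0"
  shows "\<exists>x. section_on (zeros k1 k2 s) I x \<and> x t0 = x0"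
proof -
  obtain y1 where y1: "Im x0 < y1" "cos (k2 * y1) = 0" "cos (k1 * y1) \<noteq> 0"
    using barriers_unbounded[OF k] by metis
  obtain y0 where y0: "- Im x0 < - y0" "cos (k2 * y0) = 0" "cos (k1 * y0) \<noteq> 0"
    using barriers_unbounded[OF k] by (metis cos_minus minus_minus mult_minus_right)
  define U where "U = {x. y0 < Im x \<and> Im x < y1}"
  have U: "open U" "x0 \<in> U"
    unfolding U_def using y0 y1 by (auto intro!: open_Collect_conj open_Collect_less continuous_intros)
  obtain x where x: "section_on (\<lambda>t. zeros k1 k2 s t \<inter> U) I x" "x t0 = x0"
  proof (rule section_extends[OF I])
    show "local_graph (\<lambda>t. zeros k1 k2 s t \<inter> U) t x" if "t \<in> I" "x \<in> zeros k1 k2 s t \<inter> U" for t x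
      using that U local_graph_Int_open[OF local_graph_zeros[OF k s]] D by blast
    show "compact {(t, x). t \<in> {a..b} \<and> x \<in> zeros k1 k2 s t \<inter> U}" for a b
      unfolding U_def by (rule compact_zeros_between_barriers[OF k s y0(2,3) y1(2,3)])
  qed (use t0 x0 U in auto)
  then show ?thesis by (auto simp: section_on_def)
qed

text \<open>The real power series also converges at complex arguments of smaller modulus, where the continuity of
  complex power series is available.\<close>

lemma real_analytic_isCont:
  assumes "real_analytic_on x I" "t0 \<in> I"
  shows "isCont x t0"
proof -
  obtain a r where r: "0 < r" and a: "\<And>t. \<bar>t - t0\<bar> < r \<Longrightarrow> (\<lambda>n. a n * of_real (t - t0) ^ n) sums x t"
    using assms unfolding real_analytic_on_def by blast
  have "summable (\<lambda>n. a n * of_real (r / 2) ^ n)"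
    using a[of "t0 + r / 2"] r by (auto simp: sums_iff)
  then have "isCont (\<lambda>z. \<Sum>n. a n * z ^ n) (of_real (t0 - t0))"
    by (rule isCont_powser) (use r in simp)
  then have "isCont (\<lambda>t. \<Sum>n. a n * of_real (t - t0) ^ n) t0"
    by (rule isCont_o2[where f = "\<lambda>t. complex_of_real (t - t0)", rotated]) (intro continuous_intros)
  moreover have "\<forall>\<^sub>F t in nhds t0. (\<Sum>n. a n * of_real (t - t0) ^ n) = x t"
    unfolding eventually_nhds_metric using a r by (auto simp: sums_iff dist_real_def)
  ultimately show ?thesis by (simp add: isCont_cong)
qed

text \<open>Analyticity of a curve of zeros is a consequence of continuity: locally a continuous curve coincides
  with the holomorphic branch, whose Taylor series it inherits.\<close>

lemma zero_curve_iff_section: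
  assumes k: "0 < k1" "k1 < k2" and s: "s = 1 \<or> s = - 1" and I: "open I"
    and D: "\<And>t x. t \<in> I \<Longrightarrow> \<not> double_zero k1 k2 s x t"
  shows "zero_curve k1 k2 s I x \<longleftrightarrow> x \<in> extensional I \<and> section_on (zeros k1 k2 s) I x"
proof
  assume "zero_curve k1 k2 s I x"
  then show "x \<in> extensional I \<and> section_on (zeros k1 k2 s) I x"
    using real_analytic_isCont[of x I] I
    by (auto simp: zero_curve_def section_on_def zeros_def continuous_on_eq_continuous_at)
next
  assume x: "x \<in> extensional I \<and> section_on (zeros k1 k2 s) I x"
  then have zero: "F k1 k2 s (x t) t = 0" if "t \<in> I" for t
    using that by (auto simp: section_on_def zeros_def)
  have "\<exists>a r. 0 < r \<and> (\<forall>t. \<bar>t - t0\<bar> < r \<longrightarrow> (\<lambda>n. a n * of_real (t - t0) ^ n) sums x t)"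
    if t0: "t0 \<in> I" for t0
  proof -
    obtain r d \<phi> where rd: "0 < r" "0 < d" and hol: "\<phi> holomorphic_on ball (of_real t0) r"
      and \<phi>: "\<And>t. \<bar>t - t0\<bar> < r \<Longrightarrow> \<phi> (of_real t) \<in> ball (x t0) d \<and>
         (\<forall>x\<in>ball (x t0) d. F k1 k2 s x t = 0 \<longleftrightarrow> x = \<phi> (of_real t))"
      by (rule local_branch[OF k s zero[OF t0] D[OF t0]]) blast
    obtain r1 where r1: "0 < r1" "ball t0 r1 \<subseteq> I" using I t0 unfolding open_contains_ball by blast
    have "isCont x t0" using x I t0 by (auto simp: section_on_def continuous_on_eq_continuous_at)
    then obtain r2 where r2: "0 < r2" "\<And>t. dist t t0 < r2 \<Longrightarrow> dist (x t) (x t0) < d"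
      using rd(2) unfolding continuous_at_eps_delta by blast
    have "(\<lambda>n. (deriv ^^ n) \<phi> (of_real t0) / fact n * of_real (t - t0) ^ n) sums x t"
      if t: "\<bar>t - t0\<bar> < min r (min r1 r2)" for t
    proof -
      have "t \<in> I" using r1 t by (auto simp: subset_iff dist_real_def)
      moreover have "x t \<in> ball (x t0) d" using r2(2)[of t] t by (simp add: dist_real_def dist_commute)
      moreover have "\<bar>t - t0\<bar> < r" using t by simp
      ultimately have "x t = \<phi> (of_real t)" using \<phi> zero by blast
      moreover have "of_real t \<in> ball (complex_of_real t0) r"
        using t by (simp add: dist_of_real dist_real_def abs_minus_commute)
      ultimately show ?thesis using holomorphic_power_series[OF hol, of "of_real t"] by simp
    qed
    then show ?thesis using rd r1 r2
      by (intro exI[of _ "\<lambda>n. (deriv ^^ n) \<phi> (of_real t0) / fact n"] exI[of _ "min r (min r1 r2)"]) auto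
  qed
  then show "zero_curve k1 k2 s I x"
    using x zero by (auto simp: zero_curve_def real_analytic_on_def)
qed

lemma no_double_zero:
  assumes k: "0 < k1" "k1 < k2" and s: "s = 1 \<or> s = - 1"
    and t: "t \<in> past_domain k1 k2 s \<or> t \<in> future_domain k1 k2 s"
  shows "\<not> double_zero k1 k2 s x t"
  using double_zero_exceptional[OF k s, of x t] t by (auto simp: past_domain_def future_domain_def)

section \<open>Roots of the polynomial relation when one exponential is small\<close>

text \<open>For \<open>w = 0\<close> the two relations of \<open>P_eq_0_iff\<close> give \<open>z = \<plusminus>\<i> / g\<close>.  In general \<open>h\<close> is the logarithm of
  \<open>(1 + g p) / (1 + p / g)\<close> with \<open>p = \<plusminus>\<i> s w\<close>, hence small for small \<open>w\<close>.\<close>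

lemma P_root_near_limit:
  assumes g: "1 < g" and s: "s = 1 \<or> s = - 1" and \<delta>: "0 < \<delta>"
  obtains \<eta> where "0 < \<eta>"
    "\<And>z w. P g s z w = 0 \<Longrightarrow> norm w < \<eta> \<Longrightarrow>
       \<exists>h. \<exists>\<mu>\<in>{1, -1}. norm h < \<delta> \<and> z = \<i> * \<mu> * exp h / of_real g"
proof -
  define M where "M = (\<lambda>p :: complex. Ln ((1 + of_real g * p) / (1 + p / of_real g)))"
  have "isCont M 0" unfolding M_def using g by (intro continuous_intros) auto
  then obtain \<eta> where \<eta>: "0 < \<eta>" "\<And>p. norm p < \<eta> \<Longrightarrow> norm (M p) < \<delta>"
    using \<delta> unfolding continuous_at_eps_delta by (auto simp: M_def)
  show thesis
  proof (rule that[of "min \<eta> (1 / g)"])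
    show "0 < min \<eta> (1 / g)" using \<eta> g by simp
    fix z w assume "P g s z w = 0" and w: "norm w < min \<eta> (1 / g)"
    then obtain \<sigma> where \<sigma>: "\<sigma> = 1 \<or> \<sigma> = (-1 :: complex)"
      and eq: "of_int s * w * (z - \<i> * \<sigma> * of_real g) = 1 + \<i> * \<sigma> * of_real g * z"
      unfolding P_eq_0_iff by blast
    define p where "p = \<i> * \<sigma> * of_int s * w"
    have np: "norm p = norm w" using \<sigma> s by (auto simp: p_def norm_mult)
    have gp: "norm (of_real g * p) < 1" using w g by (simp add: norm_mult np field_simps)
    have "norm p < 1 / g" using w np by simp
    also have "1 / g < g" using g by (metis divide_less_eq_1_pos less_trans zero_less_one)
    finally have pg: "norm (p / of_real g) < 1" using g by (simp add: norm_divide)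
    have n1: "1 + of_real g * p \<noteq> 0"
      using gp by (metis add_eq_0_iff norm_minus_cancel norm_one order_less_irrefl)
    have n2: "1 + p / of_real g \<noteq> 0"
      using pg by (metis add_eq_0_iff norm_minus_cancel norm_one order_less_irrefl)
    have \<sigma>\<sigma>: "\<sigma> * \<sigma> = 1" using \<sigma> by auto
    have "exp (M p) = (1 + of_real g * p) / (1 + p / of_real g)"
      using n1 n2 by (simp add: M_def exp_Ln)
    moreover have "- (\<i> * \<sigma>) * of_real g * z * (1 + p / of_real g) = 1 + of_real g * p"
    proof -
      have "- (\<i> * \<sigma>) * of_real g * z * (1 + p / of_real g)
        = - (\<i> * \<sigma> * of_real g * z) + (\<sigma> * \<sigma>) * (of_int s * w * z)"
        using g by (simp add: p_def algebra_simps)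
      also have "\<dots> = 1 + of_real g * p" using eq by (simp add: \<sigma>\<sigma> p_def algebra_simps)
      finally show ?thesis .
    qed
    ultimately have "exp (M p) = - (\<i> * \<sigma>) * of_real g * z"
      using n2 by (metis nonzero_mult_div_cancel_right)
    then have "z = \<i> * \<sigma> * exp (M p) / of_real g"
      using g \<sigma> by auto
    moreover have "norm (M p) < \<delta>" using \<eta> w np by simp
    ultimately show "\<exists>h. \<exists>\<mu>\<in>{1, -1}. norm h < \<delta> \<and> z = \<i> * \<mu> * exp h / of_real g"
      using \<sigma> by blast
  qed
qed

text \<open>Along the curve \<open>z = \<plusminus>\<i> exp h / g\<close>, \<open>w = \<kappa> exp (l h)\<close> in the space of exponentials, which is traced when \<open>x\<close>
  varies near a center and \<open>\<kappa>\<close> depends on time only, the relation can be solved for \<open>\<kappa>\<close>: up to a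
  unimodular factor \<open>\<kappa>\<close> equals \<open>K h\<close> with \<open>K\<close> holomorphic, \<open>K 0 = 0\<close> and nonzero derivative at 0.  So for every
  small \<open>\<kappa>\<close> there is exactly one small \<open>h\<close>.\<close>

lemma P_root_near_limit_unique:
  fixes l g :: real
  assumes g: "1 < g" and s: "s = 1 \<or> s = - 1" and l: "0 < l"
  obtains \<delta>0 where "0 < \<delta>0"
    "\<And>\<delta>. 0 < \<delta> \<Longrightarrow> \<delta> \<le> \<delta>0 \<Longrightarrow> \<exists>\<kappa>0>0. \<forall>\<kappa>. \<forall>\<mu>\<in>{1, -1}. norm \<kappa> < \<kappa>0 \<longrightarrow>
       (\<exists>!h. norm h < \<delta> \<and> P g s (\<i> * \<mu> * exp h / of_real g) (\<kappa> * exp (of_real l * h)) = 0)"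
proof -
  have g2: "of_real g * of_real g \<noteq> (1::complex)"
    using g less_1_mult[of g g] by (metis less_irrefl of_real_1 of_real_eq_iff of_real_mult)
  define D where "D = (\<lambda>h. of_real g - exp h / of_real g :: complex)"
  define K where "K = (\<lambda>h. (1 - exp h) / (D h) * exp (- of_real l * h))"
  \<comment> \<open>The bounds on \<open>h\<close> and \<open>exp h\<close> serve to exclude the second factor of \<open>P\<close> in \<open>key\<close>.\<close>
  define U where "U = {h. D h \<noteq> 0} \<inter> ball 0 1 \<inter> {h. norm (exp h - 1) < 1 / 2}"
  have openU: "open U" unfolding U_def D_def
    by (intro open_Int open_Collect_neq open_ball open_Collect_less continuous_intros) (use g in auto)
  have D0: "D 0 \<noteq> 0" using g2 g by (auto simp: D_def field_simps)
  then have U0: "0 \<in> U" by (simp add: U_def)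
  have hol: "K holomorphic_on U"
    unfolding K_def D_def U_def by (intro holomorphic_intros) (use g in auto)
  have K0: "K 0 = 0" by (simp add: K_def)
  have derD: "(D has_field_derivative - (1 / of_real g)) (at 0)"
    unfolding D_def using g by (auto intro!: derivative_eq_intros)
  have "(K has_field_derivative - 1 / D 0) (at 0)"
    unfolding K_def by (rule derivative_eq_intros derD refl | (use D0 in \<open>simp add: field_simps\<close>; fail))+
  then have "deriv K 0 \<noteq> 0" using D0 by (simp add: DERIV_imp_deriv)
  then obtain r where r: "0 < r" "ball 0 r \<subseteq> U" "inj_on K (ball 0 r)"
    using has_complex_derivative_locally_injective[OF hol U0 openU] by blast
  show thesis
  proof (rule that[OF r(1)])
    fix \<delta> assume \<delta>: "0 < \<delta>" "\<delta> \<le> r"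
    then have sub: "ball 0 \<delta> \<subseteq> ball (0::complex) r" by auto
    have "open (K ` ball 0 \<delta>)"
    proof (rule open_mapping_thm3)
      show "K holomorphic_on ball 0 \<delta>" using hol r(2) sub holomorphic_on_subset by blast
      show "inj_on K (ball 0 \<delta>)" using r(3) sub inj_on_subset by blast
    qed simp
    moreover have "0 \<in> K ` ball 0 \<delta>" using K0 \<delta> by (metis centre_in_ball image_eqI)
    ultimately obtain \<epsilon> where \<epsilon>: "0 < \<epsilon>" "ball 0 \<epsilon> \<subseteq> K ` ball 0 \<delta>"
      unfolding open_contains_ball by blast
    define \<kappa>0 where "\<kappa>0 = min \<epsilon> (1 / (exp l * (2 + g)))"
    have key: "P g s (\<i> * \<mu> * exp h / of_real g) (\<kappa> * exp (of_real l * h)) = 0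
      \<longleftrightarrow> K h = - \<i> * \<mu> * of_int s * \<kappa>"
      if h: "norm h < \<delta>" and \<kappa>: "norm \<kappa> < \<kappa>0" and \<mu>: "\<mu> = 1 \<or> \<mu> = (-1::complex)" for h \<kappa> \<mu>
    proof -
      define w where "w = \<kappa> * exp (of_real l * h)"
      define z where "z = \<i> * \<mu> * exp h / of_real g"
      have hU: "h \<in> U" using h sub r(2) by auto
      have Dh: "D h \<noteq> 0" and h1: "norm h < 1" and eh: "norm (exp h - 1) < 1 / 2" using hU by (auto simp: U_def)
      have \<mu>\<mu>: "\<mu> * \<mu> = 1" using \<mu> by auto
      have gz: "of_real g * z = \<i> * \<mu> * exp h" using g by (simp add: z_def)
      \<comment> \<open>The relation with the opposite sign would need a product with the small \<open>w\<close> to be close to 2.\<close>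
      have "of_int s * w * (z - \<i> * (- \<mu>) * of_real g) \<noteq> 1 + \<i> * (- \<mu>) * of_real g * z"
      proof
        assume "of_int s * w * (z - \<i> * (- \<mu>) * of_real g) = 1 + \<i> * (- \<mu>) * of_real g * z"
        also have "\<dots> = 1 + \<mu> * \<mu> * exp h" using gz by (simp add: algebra_simps)
        also have "\<dots> = 2 + (exp h - 1)" by (simp add: \<mu>\<mu>)
        finally have "norm (of_int s * w * (z - \<i> * (- \<mu>) * of_real g)) = norm (2 + (exp h - 1))"
          by (rule arg_cong)
        then have e: "norm w * norm (z + \<i> * \<mu> * of_real g) = norm (2 + (exp h - 1))"
          using s by (auto simp: norm_mult)
        have "norm (2 + (exp h - 1)) \<ge> 3 / 2"
          using norm_diff_ineq[of 2 "exp h - 1"] eh by simp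
        moreover have "norm (exp h) \<le> 3 / 2"
          using norm_triangle_ineq[of 1 "exp h - 1"] eh by simp
        then have "norm z \<le> 3 / 2" using \<mu> g
          by (auto simp: z_def norm_mult norm_divide field_simps)
        then have "norm (z + \<i> * \<mu> * of_real g) \<le> 2 + g"
          using norm_triangle_ineq[of z "\<i> * \<mu> * of_real g"] \<mu> g by (auto simp: norm_mult)
        moreover have "norm w \<le> 1 / (2 + g)"
        proof -
          have "norm (exp (of_real l * h)) \<le> exp (norm (of_real l * h))" by (rule norm_exp)
          also have "\<dots> \<le> exp l" using l h1 by (simp add: norm_mult)
          finally have "norm w \<le> norm \<kappa> * exp l" by (simp add: w_def norm_mult mult_left_mono)
          also have "\<dots> \<le> 1 / (exp l * (2 + g)) * exp l"
            using \<kappa> by (intro mult_right_mono) (auto simp: \<kappa>0_def)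
          finally show ?thesis by simp
        qed
        ultimately have "norm w * norm (z + \<i> * \<mu> * of_real g) \<le> 1 / (2 + g) * (2 + g)"
          using g by (intro mult_mono) auto
        then show False using e \<open>norm (2 + (exp h - 1)) \<ge> 3 / 2\<close> g by simp
      qed
      then have "P g s z w = 0 \<longleftrightarrow> of_int s * w * (z - \<i> * \<mu> * of_real g) = 1 + \<i> * \<mu> * of_real g * z"
        using \<mu> by (auto simp: P_eq_0_iff)
      also have "1 + \<i> * \<mu> * of_real g * z = 1 - exp h"
        using gz \<mu>\<mu> by (simp add: mult_ac)
      also have "z - \<i> * \<mu> * of_real g = - \<i> * \<mu> * D h"
        using g by (simp add: z_def D_def algebra_simps)
      also have "of_int s * w * (- \<i> * \<mu> * D h) = 1 - exp h \<longleftrightarrow>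
         (- \<i> * \<mu> * of_int s * \<kappa>) * exp (of_real l * h) = (1 - exp h) / D h"
        using Dh by (simp add: field_simps w_def)
      also have "\<dots> \<longleftrightarrow> K h = - \<i> * \<mu> * of_int s * \<kappa>"
      proof -
        have "K h = (1 - exp h) / D h / exp (of_real l * h)"
          by (simp only: K_def mult_minus_left exp_minus divide_inverse[of _ "exp _"])
        then show ?thesis
          by (metis exp_not_eq_zero nonzero_divide_eq_eq)
      qed
      finally show ?thesis by (simp add: z_def w_def)
    qed
    show "\<exists>\<kappa>0>0. \<forall>\<kappa>. \<forall>\<mu>\<in>{1, -1}. norm \<kappa> < \<kappa>0 \<longrightarrow>
       (\<exists>!h. norm h < \<delta> \<and> P g s (\<i> * \<mu> * exp h / of_real g) (\<kappa> * exp (of_real l * h)) = 0)"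
    proof (intro exI[of _ \<kappa>0] conjI allI ballI impI)
      show "0 < \<kappa>0" using \<epsilon> g by (simp add: \<kappa>0_def)
      fix \<kappa> \<mu> :: complex assume \<mu>: "\<mu> \<in> {1, -1}" and \<kappa>: "norm \<kappa> < \<kappa>0"
      have "norm (- \<i> * \<mu> * of_int s * \<kappa>) < \<epsilon>"
        using \<mu> \<kappa> s by (auto simp: norm_mult \<kappa>0_def)
      then have "- \<i> * \<mu> * of_int s * \<kappa> \<in> K ` ball 0 \<delta>" using \<epsilon>(2) by (auto simp: subset_iff)
      then obtain h where h: "norm h < \<delta>" "K h = - \<i> * \<mu> * of_int s * \<kappa>" by auto
      show "\<exists>!h. norm h < \<delta> \<and> P g s (\<i> * \<mu> * exp h / of_real g) (\<kappa> * exp (of_real l * h)) = 0"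
      proof (rule ex1I[of _ h])
        show "norm h < \<delta> \<and> P g s (\<i> * \<mu> * exp h / of_real g) (\<kappa> * exp (of_real l * h)) = 0"
          using key[of h \<kappa> \<mu>] h \<kappa> \<mu> by blast
        fix h' assume h': "norm h' < \<delta> \<and> P g s (\<i> * \<mu> * exp h' / of_real g) (\<kappa> * exp (of_real l * h')) = 0"
        then have "K h' = K h" using key[of h' \<kappa> \<mu>] h \<kappa> \<mu> by auto
        then show "h' = h" using r(3) h h' \<delta> by (auto simp: inj_on_def)
      qed
    qed
  qed
qed

section \<open>The zeros for large negative times\<close>

lemma eventually_exp_less_at_bot:
  fixes a b \<eta> :: real
  assumes "0 < a" "0 < \<eta>"
  shows "\<forall>\<^sub>F t in at_bot. exp (a * t + b) < \<eta>"
  using eventually_gt_at_bot[of "(ln \<eta> - b) / a"]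
proof eventually_elim
  case (elim t)
  then have "a * t + b < ln \<eta>" using assms by (simp add: field_simps)
  then show ?case using assms by (metis exp_less_cancel_iff exp_ln)
qed

text \<open>The square of this number is \<open>exp (- m \<pi> \<i>) = - 1\<close>.\<close>

lemma exp_odd_quarter_turn:
  assumes "odd (m :: int)"
  shows "\<exists>\<mu>\<in>{1, -1}. exp (- (of_int m * of_real pi * \<i> / 2)) = \<i> * \<mu>"
proof -
  let ?e = "exp (- (of_int m * of_real pi * \<i> / 2)) :: complex"
  obtain j where j: "m = 2 * j + 1" using assms by (rule oddE)
  have "?e * ?e = exp (- (of_int m * of_real pi * \<i>))" by (simp add: mult_ac flip: exp_add)
  also have "- (of_int m * of_real pi * \<i>) = - (of_real pi * \<i>) + (of_int (2 * (- j)) * (of_real pi * \<i>))"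
    by (simp add: j algebra_simps)
  also have "exp \<dots> = exp (- (of_real pi * \<i>))"
    by (subst exp_eq) (auto simp: mult.assoc intro!: exI[of _ "- j"])
  also have "\<dots> = - 1" by (simp add: exp_minus)
  finally have "(?e - \<i>) * (?e + \<i>) = 0" by (simp add: algebra_simps)
  then have "?e = \<i> * 1 \<or> ?e = \<i> * (- 1)"
    by (simp add: eq_neg_iff_add_eq_0)
  then show ?thesis by blast
qed

lemma expf_shift: "expf k (x + d) t = expf k x t * exp (- of_real k * d)"
  unfolding expf_def exp_add[symmetric] by (rule arg_cong[of _ _ exp]) (simp add: algebra_simps)

lemma exp_of_real_ln_gam: "0 < k1 \<Longrightarrow> k1 < k2 \<Longrightarrow> exp (of_real (ln (gam k1 k2))) = (of_real (gam k1 k2) :: complex)"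
  by (metis exp_ln exp_of_real gam_gt_1 less_trans zero_less_one)

lemma expf_slow_past:
  assumes "0 < k1" "k1 < k2"
  shows "expf k1 (slow_past k1 k2 m t) t = exp (- (of_int m * of_real pi * \<i> / 2)) / of_real (gam k1 k2)"
proof -
  have "- of_real k1 * slow_past k1 k2 m t + of_real (k1 ^ 3 * t) =
     - (of_int m * of_real pi * \<i> / 2) - of_real (ln (gam k1 k2))"
    using assms by (simp add: slow_past_def field_simps power2_eq_square power3_eq_cube)
  then show ?thesis unfolding expf_def by (simp only: exp_diff exp_of_real_ln_gam[OF assms])
qed

lemma expf_fast_past:
  assumes "0 < k1" "k1 < k2"
  shows "expf k2 (fast_past k1 k2 m t) t = exp (- (of_int m * of_real pi * \<i> / 2)) * of_real (gam k1 k2)"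
proof -
  have "- of_real k2 * fast_past k1 k2 m t + of_real (k2 ^ 3 * t) =
     - (of_int m * of_real pi * \<i> / 2) + of_real (ln (gam k1 k2))"
    using assms by (simp add: fast_past_def field_simps power2_eq_square power3_eq_cube)
  then show ?thesis unfolding expf_def by (simp only: exp_add exp_of_real_ln_gam[OF assms])
qed

text \<open>A chart \<open>h \<mapsto> c m t + a * h\<close> around the center transports \<open>P_root_near_limit_unique\<close> to \<open>F\<close>.  It is used twice:
  for slow centers with the pair of exponentials itself, for fast centers with the inverted
  pair of \<open>P_inverse\<close>.\<close>

lemma unique_zero_in_disc:
  fixes a :: complex and l g k1 k2 :: real
  assumes g: "1 < g" and s: "s = 1 \<or> s = - 1" and l: "0 < l" and a: "a \<noteq> 0"
    and chart: "\<And>m. odd m \<Longrightarrow> \<exists>\<mu>\<in>{1, -1}. \<forall>t h. F k1 k2 s (c m t + a * h) t = 0 \<longleftrightarrow>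
       P g s (\<i> * \<mu> * exp h / of_real g) (\<kappa> m t * exp (of_real l * h)) = 0"
    and small: "\<And>\<eta>. 0 < \<eta> \<Longrightarrow> \<forall>\<^sub>F t in at_bot. \<forall>m::int. norm (\<kappa> m t) < \<eta>"
  obtains \<delta>0 where "0 < \<delta>0" "\<And>\<delta>. 0 < \<delta> \<Longrightarrow> \<delta> \<le> \<delta>0 \<Longrightarrow>
      \<forall>\<^sub>F t in at_bot. \<forall>m. odd m \<longrightarrow> (\<exists>!x. dist x (c m t) < \<delta> \<and> F k1 k2 s x t = 0)"
proof -
  obtain \<delta>0 where \<delta>0: "0 < \<delta>0"
    and \<delta>0': "\<And>\<delta>. 0 < \<delta> \<Longrightarrow> \<delta> \<le> \<delta>0 \<Longrightarrow> \<exists>\<kappa>0>0. \<forall>\<kappa>. \<forall>\<mu>\<in>{1, -1}. norm \<kappa> < \<kappa>0 \<longrightarrow>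
       (\<exists>!h. norm h < \<delta> \<and> P g s (\<i> * \<mu> * exp h / of_real g) (\<kappa> * exp (of_real l * h)) = 0)"
    by (rule P_root_near_limit_unique[OF g s l]) blast
  have na: "0 < norm a" using a by simp
  show thesis
  proof (rule that[of "norm a * \<delta>0"])
    show "0 < norm a * \<delta>0" using na \<delta>0 by simp
    fix \<delta> assume \<delta>: "0 < \<delta>" "\<delta> \<le> norm a * \<delta>0"
    have "0 < \<delta> / norm a" "\<delta> / norm a \<le> \<delta>0" using \<delta> na by (auto simp: field_simps)
    from \<delta>0'[OF this] obtain \<kappa>0 where \<kappa>0: "0 < \<kappa>0"
      "\<And>\<kappa> \<mu>. \<mu> \<in> {1, -1} \<Longrightarrow> norm \<kappa> < \<kappa>0 \<Longrightarrow>
       (\<exists>!h. norm h < \<delta> / norm a \<and> P g s (\<i> * \<mu> * exp h / of_real g) (\<kappa> * exp (of_real l * h)) = 0)"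
      by blast
    from small[OF \<kappa>0(1)]
    show "\<forall>\<^sub>F t in at_bot. \<forall>m. odd m \<longrightarrow> (\<exists>!x. dist x (c m t) < \<delta> \<and> F k1 k2 s x t = 0)"
    proof eventually_elim
      case (elim t)
      show ?case
      proof (intro allI impI)
        fix m :: int assume m: "odd m"
        obtain \<mu> where \<mu>: "\<mu> \<in> {1, -1}" and ch: "\<And>h. F k1 k2 s (c m t + a * h) t = 0 \<longleftrightarrow>
            P g s (\<i> * \<mu> * exp h / of_real g) (\<kappa> m t * exp (of_real l * h)) = 0"
          using chart[OF m] by blast
        have ex1: "\<exists>!h. norm h < \<delta> / norm a \<and> F k1 k2 s (c m t + a * h) t = 0"
          unfolding ch by (rule \<kappa>0(2)[OF \<mu>]) (use elim in blast)
        then obtain h where h: "norm h < \<delta> / norm a" "F k1 k2 s (c m t + a * h) t = 0" by blast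
        show "\<exists>!x. dist x (c m t) < \<delta> \<and> F k1 k2 s x t = 0"
        proof (rule ex1I[of _ "c m t + a * h"])
          show "dist (c m t + a * h) (c m t) < \<delta> \<and> F k1 k2 s (c m t + a * h) t = 0"
            using h na by (simp add: dist_norm norm_mult field_simps)
          fix x assume x: "dist x (c m t) < \<delta> \<and> F k1 k2 s x t = 0"
          define h' where "h' = (x - c m t) / a"
          have x': "x = c m t + a * h'" using a by (simp add: h'_def)
          have "norm h' < \<delta> / norm a" using x na by (simp add: h'_def norm_divide dist_norm divide_strict_right_mono)
          then have "h' = h" using ex1 h x unfolding x' by blast
          then show "x = c m t + a * h" using x' by simp
        qed
      qed
    qed
  qed
qed

lemma unique_zero_near_slow_past:
  assumes k: "0 < k1" "k1 < k2" and s: "s = 1 \<or> s = - 1"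
  obtains \<delta>0 where "0 < \<delta>0" "\<And>\<delta>. 0 < \<delta> \<Longrightarrow> \<delta> \<le> \<delta>0 \<Longrightarrow>
      \<forall>\<^sub>F t in at_bot. \<forall>m. odd m \<longrightarrow> (\<exists>!x. dist x (slow_past k1 k2 m t) < \<delta> \<and> F k1 k2 s x t = 0)"
proof (rule unique_zero_in_disc[OF gam_gt_1[OF k] s, of "k2 / k1" "- 1 / of_real k1" k1 k2 "slow_past k1 k2"
      "\<lambda>m t. expf k2 (slow_past k1 k2 m t) t"])
  show "0 < k2 / k1" "- 1 / complex_of_real k1 \<noteq> 0" using k by auto
  show "\<exists>\<mu>\<in>{1, -1}. \<forall>t h. F k1 k2 s (slow_past k1 k2 m t + - 1 / of_real k1 * h) t = 0 \<longleftrightarrow>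
       P (gam k1 k2) s (\<i> * \<mu> * exp h / of_real (gam k1 k2))
         (expf k2 (slow_past k1 k2 m t) t * exp (of_real (k2 / k1) * h)) = 0" if m: "odd m" for m
  proof -
    obtain \<mu> where \<mu>: "\<mu> \<in> {1, -1}" "exp (- (of_int m * of_real pi * \<i> / 2)) = \<i> * \<mu>"
      using exp_odd_quarter_turn[OF m] by blast
    have "expf k1 (slow_past k1 k2 m t + - 1 / of_real k1 * h) t = \<i> * \<mu> * exp h / of_real (gam k1 k2)" for t h
      unfolding expf_shift expf_slow_past[OF k] \<mu>(2) using k by simp
    moreover have "expf k2 (slow_past k1 k2 m t + - 1 / of_real k1 * h) t =
        expf k2 (slow_past k1 k2 m t) t * exp (of_real (k2 / k1) * h)" for t h
      unfolding expf_shift by simp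
    ultimately show ?thesis
      unfolding F_eq_P using \<mu>(1) by (intro bexI[of _ \<mu>]) simp_all
  qed
  fix \<eta> :: real assume "0 < \<eta>"
  have norm: "norm (expf k2 (slow_past k1 k2 m t) t) =
      exp (k2 * (k2\<^sup>2 - k1\<^sup>2) * t + (- k2 / k1 * ln (gam k1 k2)))" for m t
    using k by (simp add: norm_expf slow_past_def algebra_simps power2_eq_square power3_eq_cube)
  have pos: "0 < k2 * (k2\<^sup>2 - k1\<^sup>2)" using k by (simp add: power2_eq_square mult_strict_mono')
  show "\<forall>\<^sub>F t in at_bot. \<forall>m::int. norm (expf k2 (slow_past k1 k2 m t) t) < \<eta>"
    unfolding norm using eventually_exp_less_at_bot[OF pos \<open>0 < \<eta>\<close>] by (simp only: simp_thms)
qed (use that in blast)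

lemma unique_zero_near_fast_past:
  assumes k: "0 < k1" "k1 < k2" and s: "s = 1 \<or> s = - 1"
  obtains \<delta>0 where "0 < \<delta>0" "\<And>\<delta>. 0 < \<delta> \<Longrightarrow> \<delta> \<le> \<delta>0 \<Longrightarrow>
      \<forall>\<^sub>F t in at_bot. \<forall>m. odd m \<longrightarrow> (\<exists>!x. dist x (fast_past k1 k2 m t) < \<delta> \<and> F k1 k2 s x t = 0)"
proof (rule unique_zero_in_disc[OF gam_gt_1[OF k] s, of "k1 / k2" "1 / of_real k2" k1 k2 "fast_past k1 k2"
      "\<lambda>m t. 1 / expf k1 (fast_past k1 k2 m t) t"])
  show "0 < k1 / k2" "1 / complex_of_real k2 \<noteq> 0" using k by auto
  show "\<exists>\<mu>\<in>{1, -1}. \<forall>t h. F k1 k2 s (fast_past k1 k2 m t + 1 / of_real k2 * h) t = 0 \<longleftrightarrow>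
       P (gam k1 k2) s (\<i> * \<mu> * exp h / of_real (gam k1 k2))
         (1 / expf k1 (fast_past k1 k2 m t) t * exp (of_real (k1 / k2) * h)) = 0" if m: "odd m" for m
  proof -
    obtain \<mu> where \<mu>: "\<mu> \<in> {1, -1}" "exp (- (of_int m * of_real pi * \<i> / 2)) = \<i> * \<mu>"
      using exp_odd_quarter_turn[OF m] by blast
    have "1 / expf k2 (fast_past k1 k2 m t + 1 / of_real k2 * h) t = \<i> * (- \<mu>) * exp h / of_real (gam k1 k2)"
      for t h unfolding expf_shift expf_fast_past[OF k] \<mu>(2)
      using k \<mu>(1) gam_gt_1[OF k] by (auto simp: exp_minus field_simps)
    moreover have "1 / expf k1 (fast_past k1 k2 m t + 1 / of_real k2 * h) t =
      1 / expf k1 (fast_past k1 k2 m t) t * exp (of_real (k1 / k2) * h)" for t h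
      unfolding expf_shift using k by (simp add: exp_minus field_simps)
    ultimately have "F k1 k2 s (fast_past k1 k2 m t + 1 / of_real k2 * h) t = 0 \<longleftrightarrow>
       P (gam k1 k2) s (\<i> * (- \<mu>) * exp h / of_real (gam k1 k2))
         (1 / expf k1 (fast_past k1 k2 m t) t * exp (of_real (k1 / k2) * h)) = 0" for t h
      using P_inverse[OF s expf_nonzero expf_nonzero] unfolding F_eq_P by metis
    then show ?thesis using \<mu>(1) by (intro bexI[of _ "- \<mu>"]) auto
  qed
  fix \<eta> :: real assume "0 < \<eta>"
  have norm: "norm (1 / expf k1 (fast_past k1 k2 m t) t) =
      exp (k1 * (k2\<^sup>2 - k1\<^sup>2) * t + (- k1 / k2 * ln (gam k1 k2)))" for m t
  proof -
    have "norm (1 / expf k1 (fast_past k1 k2 m t) t) = exp (- (- k1 * Re (fast_past k1 k2 m t) + k1 ^ 3 * t))"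
      by (simp only: norm_divide norm_one norm_expf inverse_eq_divide
          exp_minus[of "- k1 * Re (fast_past k1 k2 m t) + k1 ^ 3 * t"])
    also have "- (- k1 * Re (fast_past k1 k2 m t) + k1 ^ 3 * t) =
      k1 * (k2\<^sup>2 - k1\<^sup>2) * t + (- k1 / k2 * ln (gam k1 k2))"
      by (simp add: fast_past_def algebra_simps power2_eq_square power3_eq_cube)
    finally show ?thesis .
  qed
  have pos: "0 < k1 * (k2\<^sup>2 - k1\<^sup>2)" using k by (simp add: power2_eq_square mult_strict_mono')
  show "\<forall>\<^sub>F t in at_bot. \<forall>m::int. norm (1 / expf k1 (fast_past k1 k2 m t) t) < \<eta>"
    unfolding norm using eventually_exp_less_at_bot[OF pos \<open>0 < \<eta>\<close>] by (simp only: simp_thms)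
qed (use that in blast)

text \<open>Taking logarithms; the integer \<open>m\<close> collects the argument of \<open>\<i> \<mu>\<close> and the period \<open>2 \<pi> \<i>\<close>, which
  changes \<open>m\<close> by multiples of 4.\<close>

lemma slow_past_of_expf:
  assumes k: "0 < k1" "k1 < k2" and \<mu>: "\<mu> \<in> {1, -1}"
    and e: "expf k1 x t = \<i> * \<mu> * exp h / of_real (gam k1 k2)"
  shows "\<exists>m. odd m \<and> x = slow_past k1 k2 m t - h / of_real k1"
proof -
  obtain m0 :: int where m0: "odd m0" "\<i> * \<mu> = exp (- (of_int m0 * of_real pi * \<i> / 2))"
  proof (cases "\<mu> = 1")
    case True
    then show thesis by (intro that[of "-1"]) (simp_all add: complex_eq_iff Re_exp Im_exp)
  next
    case False
    then have "\<mu> = - 1" using \<mu> by auto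
    then show thesis by (intro that[of 1]) (simp_all add: complex_eq_iff Re_exp Im_exp)
  qed
  have "exp (- of_real k1 * x + of_real (k1 ^ 3 * t)) =
     exp (- (of_int m0 * of_real pi * \<i> / 2) + h - of_real (ln (gam k1 k2)))"
    unfolding exp_diff exp_add[of "- (of_int m0 * of_real pi * \<i> / 2)" h] exp_of_real_ln_gam[OF k] m0(2)[symmetric]
    using e by (simp add: expf_def)
  then obtain n :: int where n: "- of_real k1 * x + of_real (k1 ^ 3 * t) =
     - (of_int m0 * of_real pi * \<i> / 2) + h - of_real (ln (gam k1 k2)) + of_int (2 * n) * of_real pi * \<i>"
    unfolding exp_eq by auto
  then have "x = (of_real (k1 ^ 3 * t) + of_int (m0 - 4 * n) * of_real pi * \<i> / 2 - h + of_real (ln (gam k1 k2))) / of_real k1"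
    using k by (simp add: field_simps)
  also have "\<dots> = slow_past k1 k2 (m0 - 4 * n) t - h / of_real k1"
    using k by (simp add: slow_past_def field_simps power2_eq_square power3_eq_cube)
  finally show ?thesis using m0 by (intro exI[of _ "m0 - 4 * n"]) auto
qed

lemma fast_past_of_expf:
  assumes k: "0 < k1" "k1 < k2" and \<mu>: "\<mu> \<in> {1, -1}"
    and e: "1 / expf k2 x t = \<i> * \<mu> * exp h / of_real (gam k1 k2)"
  shows "\<exists>m. odd m \<and> x = fast_past k1 k2 m t + h / of_real k2"
proof -
  obtain m0 :: int where m0: "odd m0" "- (\<i> * \<mu>) = exp (- (of_int m0 * of_real pi * \<i> / 2))"
  proof (cases "\<mu> = 1")
    case True
    then show thesis by (intro that[of 1]) (simp_all add: complex_eq_iff Re_exp Im_exp)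
  next
    case False
    then have "\<mu> = - 1" using \<mu> by auto
    then show thesis by (intro that[of "-1"]) (simp_all add: complex_eq_iff Re_exp Im_exp)
  qed
  have "exp (- of_real k2 * x + of_real (k2 ^ 3 * t)) = - (\<i> * \<mu>) * of_real (gam k1 k2) / exp h"
  proof -
    have g: "of_real (gam k1 k2) \<noteq> (0 :: complex)" using gam_gt_1[OF k] by simp
    have "expf k2 x t = 1 / (\<i> * \<mu> * exp h / of_real (gam k1 k2))" by (simp flip: e)
    also have "\<dots> = - (\<i> * \<mu>) * of_real (gam k1 k2) / exp h"
      using \<mu> g by (auto simp: field_simps)
    finally show ?thesis by (simp add: expf_def)
  qed
  also have "\<dots> = exp (- (of_int m0 * of_real pi * \<i> / 2) + of_real (ln (gam k1 k2)) - h)"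
    unfolding m0(2) exp_diff exp_add[of "- (of_int m0 * of_real pi * \<i> / 2)"] exp_of_real_ln_gam[OF k] ..
  finally obtain n :: int where n: "- of_real k2 * x + of_real (k2 ^ 3 * t) =
     - (of_int m0 * of_real pi * \<i> / 2) + of_real (ln (gam k1 k2)) - h + of_int (2 * n) * of_real pi * \<i>"
    unfolding exp_eq by auto
  then have "x = (of_real (k2 ^ 3 * t) + of_int (m0 - 4 * n) * of_real pi * \<i> / 2 + h - of_real (ln (gam k1 k2))) / of_real k2"
    using k by (simp add: field_simps)
  also have "\<dots> = fast_past k1 k2 (m0 - 4 * n) t + h / of_real k2"
    using k by (simp add: fast_past_def field_simps power2_eq_square power3_eq_cube)
  finally show ?thesis using m0 by (intro exI[of _ "m0 - 4 * n"]) auto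
qed

text \<open>The line \<open>Re x = (k1\<^sup>2 + k2\<^sup>2) t / 2\<close> lies halfway between the two families of centers.  To the right of it the
  second exponential is small and \<open>P_root_near_limit\<close> yields a slow center; to the left of it the inverse of the
  first one is small, and the inverted pair yields a fast center.\<close>

lemma zeros_near_centers_past:
  assumes k: "0 < k1" "k1 < k2" and s: "s = 1 \<or> s = - 1" and \<delta>: "0 < \<delta>"
  shows "\<forall>\<^sub>F t in at_bot. \<forall>x\<in>zeros k1 k2 s t.
     (\<exists>m. odd m \<and> dist x (slow_past k1 k2 m t) < \<delta>) \<or> (\<exists>n. odd n \<and> dist x (fast_past k1 k2 n t) < \<delta>)"
proof -
  define g where "g = gam k1 k2"
  have g: "1 < g" using gam_gt_1[OF k] by (simp add: g_def)
  have "0 < k1 * \<delta>" using k \<delta> by simp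
  then obtain \<eta> where \<eta>: "0 < \<eta>"
    and root: "\<And>z w. P g s z w = 0 \<Longrightarrow> norm w < \<eta> \<Longrightarrow>
       \<exists>h. \<exists>\<mu>\<in>{1, -1}. norm h < k1 * \<delta> \<and> z = \<i> * \<mu> * exp h / of_real g"
    by (rule P_root_near_limit[OF g s]) blast
  define q where "q = (k2\<^sup>2 - k1\<^sup>2) / 2"
  have q: "0 < q" using k by (simp add: q_def power_strict_mono)
  have "\<forall>\<^sub>F t in at_bot. exp (k2 * q * t + 0) < \<eta>" "\<forall>\<^sub>F t in at_bot. exp (k1 * q * t + 0) < \<eta>"
    using k q \<eta> by (intro eventually_exp_less_at_bot; simp)+
  then show ?thesis
  proof eventually_elim
    case (elim t)
    show ?case
    proof
      fix x assume "x \<in> zeros k1 k2 s t"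
      then have P: "P g s (expf k1 x t) (expf k2 x t) = 0" by (simp add: zeros_def F_eq_P g_def)
      show "(\<exists>m. odd m \<and> dist x (slow_past k1 k2 m t) < \<delta>) \<or> (\<exists>n. odd n \<and> dist x (fast_past k1 k2 n t) < \<delta>)"
      proof (cases "Re x \<ge> (k1\<^sup>2 + k2\<^sup>2) / 2 * t")
        case True
        then have "k2 * ((k1\<^sup>2 + k2\<^sup>2) / 2 * t) \<le> k2 * Re x" using k by (intro mult_left_mono) auto
        moreover have "k2 ^ 3 * t - k2 * ((k1\<^sup>2 + k2\<^sup>2) / 2 * t) = k2 * q * t"
          by (simp add: q_def field_simps power2_eq_square power3_eq_cube)
        ultimately have "norm (expf k2 x t) \<le> exp (k2 * q * t + 0)" by (simp add: norm_expf)
        then have "norm (expf k2 x t) < \<eta>" using elim(1) by linarith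
        from root[OF P this] obtain h \<mu> where h: "\<mu> \<in> {1, -1}" "norm h < k1 * \<delta>"
          "expf k1 x t = \<i> * \<mu> * exp h / of_real (gam k1 k2)" unfolding g_def by blast
        obtain m where m: "odd m" "x = slow_past k1 k2 m t - h / of_real k1"
          using slow_past_of_expf[OF k h(1,3)] by blast
        have "dist x (slow_past k1 k2 m t) < \<delta>"
          using h(2) k by (simp add: m(2) dist_norm norm_divide field_simps)
        then show ?thesis using m(1) by blast
      next
        case False
        then have "k1 * Re x \<le> k1 * ((k1\<^sup>2 + k2\<^sup>2) / 2 * t)" using k by (intro mult_left_mono) auto
        moreover have "k1 * ((k1\<^sup>2 + k2\<^sup>2) / 2 * t) - k1 ^ 3 * t = k1 * q * t"
          by (simp add: q_def field_simps power2_eq_square power3_eq_cube)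
        ultimately have "exp (- (- k1 * Re x + k1 ^ 3 * t)) \<le> exp (k1 * q * t + 0)" by simp
        then have "norm (1 / expf k1 x t) \<le> exp (k1 * q * t + 0)"
          by (simp only: norm_divide norm_one norm_expf exp_minus[of "- k1 * Re x + k1 ^ 3 * t"] inverse_eq_divide)
        then have small: "norm (1 / expf k1 x t) < \<eta>" using elim(2) by linarith
        have "P g s (1 / expf k2 x t) (1 / expf k1 x t) = 0"
          using P P_inverse[OF s] by simp
        from root[OF this small] obtain h \<mu> where h: "\<mu> \<in> {1, -1}" "norm h < k1 * \<delta>"
          "1 / expf k2 x t = \<i> * \<mu> * exp h / of_real (gam k1 k2)" unfolding g_def by blast
        obtain m where m: "odd m" "x = fast_past k1 k2 m t + h / of_real k2"
          using fast_past_of_expf[OF k h(1,3)] by blast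
        have "norm h < k2 * \<delta>" using h(2) k \<delta> by (meson less_trans mult_strict_right_mono)
        then have "dist x (fast_past k1 k2 m t) < \<delta>"
          using k by (simp add: m(2) dist_norm norm_divide field_simps)
        then show ?thesis using m(1) by blast
      qed
    qed
  qed
qed

text \<open>The real parts of slow and fast centers move apart linearly in \<open>t\<close>.\<close>

lemma centers_separate_past:
  assumes k: "0 < k1" "k1 < k2"
  shows "\<forall>\<^sub>F t in at_bot. \<forall>m n. pi / (2 * k2) \<le> dist (slow_past k1 k2 m t) (fast_past k1 k2 n t)"
proof -
  define q where "q = k2\<^sup>2 - k1\<^sup>2"
  have q: "0 < q" using k by (simp add: q_def power_strict_mono)
  define L where "L = 1 / k1 * ln (gam k1 k2) + 1 / k2 * ln (gam k1 k2)"
  show ?thesis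
    using eventually_gt_at_bot[of "(L - pi / (2 * k2)) / q"]
  proof eventually_elim
    case (elim t)
    then have 1: "pi / (2 * k2) \<le> L - q * t" using q by (simp add: field_simps)
    show ?case
    proof (intro allI)
      fix m n
      have "Re (slow_past k1 k2 m t - fast_past k1 k2 n t) = L - q * t"
        using k by (simp add: slow_past_def fast_past_def L_def q_def algebra_simps)
      then have "L - q * t \<le> dist (slow_past k1 k2 m t) (fast_past k1 k2 n t)"
        using complex_Re_le_cmod[of "slow_past k1 k2 m t - fast_past k1 k2 n t"] by (simp add: dist_norm)
      with 1 show "pi / (2 * k2) \<le> dist (slow_past k1 k2 m t) (fast_past k1 k2 n t)" by linarith
    qed
  qed
qed

lemma lattice_separation:
  assumes "0 < k" "m \<noteq> (n::int)"
    and "x - y = of_int (m - n) * of_real pi * \<i> / (2 * of_real k)"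
  shows "pi / (2 * k) \<le> dist x y"
proof -
  have "dist x y = \<bar>of_int (m - n)\<bar> * pi / (2 * k)"
    using assms by (simp add: dist_norm norm_mult norm_divide del: of_int_diff)
  moreover have "1 \<le> \<bar>real_of_int (m - n)\<bar>" using assms(2) by linarith
  then have "1 * pi / (2 * k) \<le> \<bar>of_int (m - n)\<bar> * pi / (2 * k)"
    using assms(1) by (intro divide_right_mono mult_right_mono) auto
  ultimately show ?thesis by simp
qed

section \<open>Sections that follow moving centers\<close>

text \<open>Sets \<open>Z t\<close> that, as \<open>t \<rightarrow> -\<infinity>\<close>, consist of exactly one point in each small disc around one of the
  centers \<open>c i t\<close>, the centers keeping a distance \<open>2 * \<delta>1\<close>.  The conclusion is a bijection between
  sections and centers.\<close>

locale tracked_zeros =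
  fixes Z :: "real \<Rightarrow> complex set" and I :: "real set" and c :: "'i \<Rightarrow> real \<Rightarrow> complex" and N :: "'i set"
    and \<delta>0 \<delta>1 :: real
  assumes I: "connected I" "{..<0} \<subseteq> I"
    and loc: "\<And>t x. t \<in> I \<Longrightarrow> x \<in> Z t \<Longrightarrow> local_graph Z t x"
    and ext: "\<And>t x. t \<in> I \<Longrightarrow> x \<in> Z t \<Longrightarrow> \<exists>y. section_on Z I y \<and> y t = x"
    and cont: "\<And>i. continuous_on UNIV (c i)"
    and \<delta>0: "0 < \<delta>0" and \<delta>1: "0 < \<delta>1"
    and disc: "\<And>\<delta>. 0 < \<delta> \<Longrightarrow> \<delta> \<le> \<delta>0 \<Longrightarrow>
      \<forall>\<^sub>F t in at_bot. \<forall>i\<in>N. \<exists>!x. dist x (c i t) < \<delta> \<and> x \<in> Z t"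
    and sep: "\<forall>\<^sub>F t in at_bot. \<forall>i\<in>N. \<forall>j\<in>N. i \<noteq> j \<longrightarrow> 2 * \<delta>1 \<le> dist (c i t) (c j t)"
    and cover: "\<And>\<delta>. 0 < \<delta> \<Longrightarrow> \<forall>\<^sub>F t in at_bot. \<forall>x\<in>Z t. \<exists>i\<in>N. dist x (c i t) < \<delta>"
begin

text \<open>For \<open>t < T\<close> the discs of radius \<open>\<delta>\<close> are disjoint and cover \<open>Z t\<close>.  The times at which a section lies in
  the disc around \<open>c i\<close> therefore form a clopen subset of \<open>{..<T}\<close>.  A section that stays in the
  disc converges to the center, since smaller discs also cover.\<close>

lemma discs_trap_sections:
  obtains T \<delta> where "T < 0" "0 < \<delta>"
    "\<And>t. t < T \<Longrightarrow> \<forall>i\<in>N. \<exists>!x. dist x (c i t) < \<delta> \<and> x \<in> Z t"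
    "\<And>t x. t < T \<Longrightarrow> x \<in> Z t \<Longrightarrow> \<exists>i\<in>N. dist x (c i t) < \<delta>"
    "\<And>x i t. section_on Z I x \<Longrightarrow> i \<in> N \<Longrightarrow> t < T \<Longrightarrow> dist (x t) (c i t) < \<delta> \<Longrightarrow>
       ((\<lambda>t. x t - c i t) \<longlongrightarrow> 0) at_bot"
proof -
  define \<delta> where "\<delta> = min \<delta>0 \<delta>1"
  have \<delta>: "0 < \<delta>" "\<delta> \<le> \<delta>0" "\<delta> \<le> \<delta>1" using \<delta>0 \<delta>1 by (auto simp: \<delta>_def)
  have "\<forall>\<^sub>F t in at_bot. (\<forall>i\<in>N. \<exists>!x. dist x (c i t) < \<delta> \<and> x \<in> Z t) \<and>
     (\<forall>i\<in>N. \<forall>j\<in>N. i \<noteq> j \<longrightarrow> 2 * \<delta>1 \<le> dist (c i t) (c j t)) \<and>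
     (\<forall>x\<in>Z t. \<exists>i\<in>N. dist x (c i t) < \<delta>)"
    using disc[OF \<delta>(1,2)] sep cover[OF \<delta>(1)] by eventually_elim auto
  then obtain T' where T': "\<And>t. t \<le> T' \<Longrightarrow> (\<forall>i\<in>N. \<exists>!x. dist x (c i t) < \<delta> \<and> x \<in> Z t) \<and>
     (\<forall>i\<in>N. \<forall>j\<in>N. i \<noteq> j \<longrightarrow> 2 * \<delta>1 \<le> dist (c i t) (c j t)) \<and>
     (\<forall>x\<in>Z t. \<exists>i\<in>N. dist x (c i t) < \<delta>)"
    unfolding eventually_at_bot_linorder by auto
  define T where "T = min T' (-1)"
  have T0: "T < 0" by (simp add: T_def)
  have T1: "\<exists>!x. dist x (c i t) < \<delta> \<and> x \<in> Z t" if "t < T" "i \<in> N" for i t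
    using T'[of t] that by (auto simp: T_def)
  have T2: "i = j" if "t < T" "i \<in> N" "j \<in> N" "dist (c i t) (c j t) < 2 * \<delta>1" for i j t
    using T'[of t] that by (force simp: T_def)
  have T3: "\<exists>i\<in>N. dist x (c i t) < \<delta>" if "t < T" "x \<in> Z t" for t x
    using T'[of t] that by (auto simp: T_def)
  have same: "i = j" if "t < T" "i \<in> N" "j \<in> N" "dist x (c i t) \<le> \<delta>" "dist x (c j t) < \<delta>" for i j t x
  proof (rule T2)
    have "dist (c i t) (c j t) \<le> dist x (c i t) + dist x (c j t)"
      by (metis dist_commute dist_triangle)
    then show "dist (c i t) (c j t) < 2 * \<delta>1" using that \<delta> by linarith
  qed (use that in auto)
  show thesis
  proof (rule that[OF T0 \<delta>(1)])
    fix x i t assume x: "section_on Z I x" and i: "i \<in> N" and t: "t < T" "dist (x t) (c i t) < \<delta>"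
    have sub: "{..<T} \<subseteq> I" using I(2) T0 by auto
    have xZ: "x u \<in> Z u" if "u < T" for u using x sub that by (auto simp: section_on_def)
    have cd: "continuous_on {..<T} (\<lambda>u. dist (x u) (c i u))"
      using x sub by (intro continuous_intros)
        (auto simp: section_on_def intro: continuous_on_subset[OF cont] continuous_on_subset)
    define A where "A = {..<T} \<inter> (\<lambda>u. dist (x u) (c i u)) -` {..<\<delta>}"
    \<comment> \<open>A point in the closed disc lies in some open disc, which must be the one with the same center.\<close>
    have A': "A = {..<T} \<inter> (\<lambda>u. dist (x u) (c i u)) -` {..\<delta>}"
    proof -
      have "dist (x u) (c i u) < \<delta>" if u: "u < T" "dist (x u) (c i u) \<le> \<delta>" for u
      proof -
        obtain j where j: "j \<in> N" "dist (x u) (c j u) < \<delta>" using T3[OF u(1) xZ[OF u(1)]] by blast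
        then have "i = j" using same[OF u(1) i j(1) u(2) j(2)] by simp
        then show ?thesis using j by simp
      qed
      then show ?thesis by (auto simp: A_def)
    qed
    have "openin (top_of_set {..<T}) A"
      unfolding A_def by (rule continuous_openin_preimage_gen[OF cd open_lessThan])
    moreover have "closedin (top_of_set {..<T}) A"
      unfolding A' by (rule continuous_closedin_preimage[OF cd closed_atMost])
    moreover have "t \<in> A" using t by (simp add: A_def)
    moreover have "connected {..<T}" by simp
    ultimately have A: "A = {..<T}" unfolding connected_clopen by blast
    show "((\<lambda>t. x t - c i t) \<longlongrightarrow> 0) at_bot"
    proof (rule tendstoI)
      fix \<epsilon> :: real assume "0 < \<epsilon>"
      then have "0 < min \<epsilon> \<delta>" using \<delta> by simp
      from cover[OF this] eventually_gt_at_bot[of T]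
      show "\<forall>\<^sub>F u in at_bot. dist (x u - c i u) 0 < \<epsilon>"
      proof eventually_elim
        case (elim u)
        then obtain j where j: "j \<in> N" "dist (x u) (c j u) < min \<epsilon> \<delta>" using xZ by blast
        have "dist (x u) (c i u) < \<delta>" using A elim(2) by (auto simp: A_def)
        then have "i = j" using same[OF elim(2) i j(1)] j(2) by force
        then show ?case using j by (simp add: dist_norm)
      qed
    qed
  qed (use T1 T3 in auto)
qed

lemma section_follows_center:
  assumes "section_on Z I x"
  shows "\<exists>i\<in>N. ((\<lambda>t. x t - c i t) \<longlongrightarrow> 0) at_bot"
proof -
  obtain T \<delta> where T: "T < 0" "0 < \<delta>"
    and one: "\<And>t. t < T \<Longrightarrow> \<forall>i\<in>N. \<exists>!x. dist x (c i t) < \<delta> \<and> x \<in> Z t"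
    and cov: "\<And>t x. t < T \<Longrightarrow> x \<in> Z t \<Longrightarrow> \<exists>i\<in>N. dist x (c i t) < \<delta>"
    and trap: "\<And>x i t. section_on Z I x \<Longrightarrow> i \<in> N \<Longrightarrow> t < T \<Longrightarrow> dist (x t) (c i t) < \<delta> \<Longrightarrow>
       ((\<lambda>t. x t - c i t) \<longlongrightarrow> 0) at_bot"
    by (rule discs_trap_sections) blast
  have T1: "T - 1 < T" by simp
  have "T - 1 \<in> I" using I(2) T(1) by auto
  then have "x (T - 1) \<in> Z (T - 1)" using assms by (auto simp: section_on_def)
  then obtain i where i: "i \<in> N" "dist (x (T - 1)) (c i (T - 1)) < \<delta>"
    using cov[OF T1] by blast
  then show ?thesis using trap[OF assms i(1) T1 i(2)] by blast
qed

text \<open>A section through the unique point in the disc at one early time follows the center.  Two such sections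
  both lie in the disc at some early time, so they meet there and coincide.\<close>

lemma ex1_section_at_center:
  assumes i: "i \<in> N"
  shows "\<exists>!x. x \<in> extensional I \<and> section_on Z I x \<and> ((\<lambda>t. x t - c i t) \<longlongrightarrow> 0) at_bot"
proof -
  obtain T \<delta> where T: "T < 0" "0 < \<delta>"
    and one: "\<And>t. t < T \<Longrightarrow> \<forall>i\<in>N. \<exists>!x. dist x (c i t) < \<delta> \<and> x \<in> Z t"
    and cov: "\<And>t x. t < T \<Longrightarrow> x \<in> Z t \<Longrightarrow> \<exists>i\<in>N. dist x (c i t) < \<delta>"
    and trap: "\<And>x i t. section_on Z I x \<Longrightarrow> i \<in> N \<Longrightarrow> t < T \<Longrightarrow> dist (x t) (c i t) < \<delta> \<Longrightarrow>
       ((\<lambda>t. x t - c i t) \<longlongrightarrow> 0) at_bot"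
    by (rule discs_trap_sections) blast
  have T1: "T - 1 \<in> I" using I(2) T(1) by auto
  obtain x0 where x0: "dist x0 (c i (T - 1)) < \<delta>" "x0 \<in> Z (T - 1)"
    using one[of "T - 1"] i by auto
  obtain y where y: "section_on Z I y" "y (T - 1) = x0" using ext[OF T1 x0(2)] by blast
  have y': "section_on Z I (restrict y I)"
    using y(1) by (auto simp: section_on_def cong: continuous_on_cong)
  show ?thesis
  proof (rule ex1I[of _ "restrict y I"], intro conjI)
    show "((\<lambda>t. restrict y I t - c i t) \<longlongrightarrow> 0) at_bot"
      by (rule trap[OF y' i, of "T - 1"]) (use x0 y T1 in auto)
    fix x assume x: "x \<in> extensional I \<and> section_on Z I x \<and> ((\<lambda>t. x t - c i t) \<longlongrightarrow> 0) at_bot"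
    have "\<forall>\<^sub>F t in at_bot. t < T \<and> dist (x t) (c i t) < \<delta> \<and> dist (restrict y I t) (c i t) < \<delta>"
      using eventually_gt_at_bot[of T] tendstoD[OF conjunct2[OF conjunct2[OF x]] T(2)]
        tendstoD[OF \<open>((\<lambda>t. restrict y I t - c i t) \<longlongrightarrow> 0) at_bot\<close> T(2)]
      by eventually_elim (auto simp: dist_norm)
    then obtain t where t: "t < T" "dist (x t) (c i t) < \<delta>" "dist (restrict y I t) (c i t) < \<delta>"
      using eventually_happens'[OF trivial_limit_at_bot_linorder] by blast
    then have tI: "t \<in> I" using I(2) T by auto
    have "x t = restrict y I t"
      using one[OF t(1)] i t x y' tI unfolding section_on_def by blast
    then have "x u = restrict y I u" if "u \<in> I" for u
      using section_unique[of I Z x "restrict y I" t u] loc I(1) x y' tI that by blast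
    then show "x = restrict y I"
      using x by (intro extensionalityI[of _ I]) auto
  qed (use y' in auto)
qed

end

section \<open>Curves as time tends to minus infinity\<close>

lemma smallo_one_iff: "f \<in> o[G](\<lambda>_. 1) \<longleftrightarrow> (f \<longlongrightarrow> 0) G" for f :: "real \<Rightarrow> complex"
  using smalloI_tendsto[of f "\<lambda>_. 1" G] smalloD_tendsto[of f G "\<lambda>_. 1"] by auto

text \<open>Slow centers carry the tag \<open>True\<close>, fast centers the tag \<open>False\<close>; this makes them one indexed family.\<close>

definition past_center :: "real \<Rightarrow> real \<Rightarrow> bool \<times> int \<Rightarrow> real \<Rightarrow> complex" where
  "past_center k1 k2 i = (if fst i then slow_past k1 k2 (snd i) else fast_past k1 k2 (snd i))"

lemma past_domain_props:
  "open (past_domain k1 k2 s)" "is_interval (past_domain k1 k2 s)" "connected (past_domain k1 k2 s)"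
  "{..<0} \<subseteq> past_domain k1 k2 s"
  by (auto simp: past_domain_def)

lemma open_future_domain: "open (future_domain k1 k2 s)"
  by (auto simp: future_domain_def)

lemma tracked_zeros_past:
  assumes k: "0 < k1" "k1 < k2" and s: "s = 1 \<or> s = - 1"
  obtains \<delta>0 \<delta>1 where
    "tracked_zeros (zeros k1 k2 s) (past_domain k1 k2 s) (past_center k1 k2) {i. odd (snd i)} \<delta>0 \<delta>1"
proof -
  let ?I = "past_domain k1 k2 s" and ?Z = "zeros k1 k2 s"
  obtain \<delta>s where \<delta>s: "0 < \<delta>s" "\<And>\<delta>. 0 < \<delta> \<Longrightarrow> \<delta> \<le> \<delta>s \<Longrightarrow>
      \<forall>\<^sub>F t in at_bot. \<forall>m. odd m \<longrightarrow> (\<exists>!x. dist x (slow_past k1 k2 m t) < \<delta> \<and> F k1 k2 s x t = 0)"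
    by (rule unique_zero_near_slow_past[OF k s]) blast
  obtain \<delta>f where \<delta>f: "0 < \<delta>f" "\<And>\<delta>. 0 < \<delta> \<Longrightarrow> \<delta> \<le> \<delta>f \<Longrightarrow>
      \<forall>\<^sub>F t in at_bot. \<forall>m. odd m \<longrightarrow> (\<exists>!x. dist x (fast_past k1 k2 m t) < \<delta> \<and> F k1 k2 s x t = 0)"
    by (rule unique_zero_near_fast_past[OF k s]) blast
  have D: "\<not> double_zero k1 k2 s x t" if "t \<in> ?I" for t x
    using no_double_zero[OF k s] that by blast
  have "tracked_zeros ?Z ?I (past_center k1 k2) {i. odd (snd i)} (min \<delta>s \<delta>f) (pi / (4 * k2))"
  proof
    show "connected ?I" "{..<0} \<subseteq> ?I" by (rule past_domain_props)+
    show "local_graph ?Z t x" if "t \<in> ?I" "x \<in> ?Z t" for t x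
      by (rule local_graph_zeros[OF k s that(2) D[OF that(1)]])
    show "\<exists>y. section_on ?Z ?I y \<and> y t = x" if "t \<in> ?I" "x \<in> ?Z t" for t x
      by (rule curve_through_zero[OF k s past_domain_props(1,2) D that])
    show "continuous_on UNIV (past_center k1 k2 i)" for i
      using k by (auto simp: past_center_def slow_past_def fast_past_def intro!: continuous_intros)
    show "0 < min \<delta>s \<delta>f" "0 < pi / (4 * k2)" using \<delta>s \<delta>f k by auto
    show "\<forall>\<^sub>F t in at_bot. \<forall>i\<in>{i. odd (snd i)}. \<exists>!x. dist x (past_center k1 k2 i t) < \<delta> \<and> x \<in> ?Z t"
      if "0 < \<delta>" "\<delta> \<le> min \<delta>s \<delta>f" for \<delta>
    proof -
      have "\<delta> \<le> \<delta>s" "\<delta> \<le> \<delta>f" using that by auto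
      from \<delta>s(2)[OF that(1) this(1)] \<delta>f(2)[OF that(1) this(2)]
      show ?thesis by eventually_elim (simp add: past_center_def zeros_def)
    qed
    show "\<forall>\<^sub>F t in at_bot. \<forall>i\<in>{i. odd (snd i)}. \<forall>j\<in>{i. odd (snd i)}. i \<noteq> j \<longrightarrow>
      2 * (pi / (4 * k2)) \<le> dist (past_center k1 k2 i t) (past_center k1 k2 j t)"
      using centers_separate_past[OF k]
    proof eventually_elim
      case (elim t)
      have "pi / (2 * k2) \<le> dist (past_center k1 k2 (p, m) t) (past_center k1 k2 (q, n) t)"
        if ne: "(p, m) \<noteq> (q, n)" for p q m n
      proof (cases "p = q")
        case False
        then show ?thesis using elim by (cases p; cases q; simp add: past_center_def dist_commute)
      next
        case True
        then have mn: "m \<noteq> n" using ne by simp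
        show ?thesis
        proof (cases p)
          case True
          have "pi / (2 * k2) \<le> pi / (2 * k1)" using k by (intro divide_left_mono) auto
          also have "\<dots> \<le> dist (slow_past k1 k2 m t) (slow_past k1 k2 n t)"
            using k by (intro lattice_separation[OF _ mn]) (simp_all add: slow_past_def algebra_simps diff_divide_distrib)
          finally show ?thesis using True \<open>p = q\<close> by (simp add: past_center_def)
        next
          case False
          have "pi / (2 * k2) \<le> dist (fast_past k1 k2 m t) (fast_past k1 k2 n t)"
            using k by (intro lattice_separation[OF _ mn]) (simp_all add: fast_past_def algebra_simps diff_divide_distrib)
          then show ?thesis using False \<open>p = q\<close> by (simp add: past_center_def)
        qed
      qed
      then show ?case by auto
    qed
    show "\<forall>\<^sub>F t in at_bot. \<forall>x\<in>?Z t. \<exists>i\<in>{i. odd (snd i)}. dist x (past_center k1 k2 i t) < \<delta>"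
      if "0 < \<delta>" for \<delta>
      using zeros_near_centers_past[OF k s that]
    proof eventually_elim
      case (elim t)
      show ?case
      proof
        fix x assume "x \<in> ?Z t"
        with elim consider m where "odd m" "dist x (slow_past k1 k2 m t) < \<delta>"
          | n where "odd n" "dist x (fast_past k1 k2 n t) < \<delta>" by blast
        then show "\<exists>i\<in>{i. odd (snd i)}. dist x (past_center k1 k2 i t) < \<delta>"
        proof cases
          case 1
          then show ?thesis by (intro bexI[of _ "(True, m)"]) (auto simp: past_center_def)
        next
          case 2
          then show ?thesis by (intro bexI[of _ "(False, n)"]) (auto simp: past_center_def)
        qed
      qed
    qed
  qed
  then show thesis by (rule that)
qed

lemma past_curves:
  assumes k: "0 < k1" "k1 < k2" and s: "s = 1 \<or> s = - 1"
  shows "odd (snd i) \<Longrightarrow> \<exists>!x. zero_curve k1 k2 s (past_domain k1 k2 s) x \<and>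
           ((\<lambda>t. x t - past_center k1 k2 i t) \<longlongrightarrow> 0) at_bot"
    and "zero_curve k1 k2 s (past_domain k1 k2 s) x \<Longrightarrow>
           \<exists>i. odd (snd i) \<and> ((\<lambda>t. x t - past_center k1 k2 i t) \<longlongrightarrow> 0) at_bot"
proof -
  obtain \<delta>0 \<delta>1 where "tracked_zeros (zeros k1 k2 s) (past_domain k1 k2 s) (past_center k1 k2) {i. odd (snd i)} \<delta>0 \<delta>1"
    by (rule tracked_zeros_past[OF k s])
  then interpret tracked_zeros "zeros k1 k2 s" "past_domain k1 k2 s" "past_center k1 k2" "{i. odd (snd i)}" \<delta>0 \<delta>1 .
  have eq: "zero_curve k1 k2 s (past_domain k1 k2 s) x \<longleftrightarrow>
      x \<in> extensional (past_domain k1 k2 s) \<and> section_on (zeros k1 k2 s) (past_domain k1 k2 s) x" for x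
    by (rule zero_curve_iff_section[OF k s past_domain_props(1)]) (use no_double_zero[OF k s] in blast)
  show "\<exists>!x. zero_curve k1 k2 s (past_domain k1 k2 s) x \<and>
           ((\<lambda>t. x t - past_center k1 k2 i t) \<longlongrightarrow> 0) at_bot" if "odd (snd i)"
    unfolding eq conj_assoc by (rule ex1_section_at_center) (use that in simp)
  show "\<exists>i. odd (snd i) \<and> ((\<lambda>t. x t - past_center k1 k2 i t) \<longlongrightarrow> 0) at_bot"
    if "zero_curve k1 k2 s (past_domain k1 k2 s) x"
    using section_follows_center[of x] that unfolding eq by blast
qed

section \<open>Curves as time tends to infinity\<close>

definition reflect_curve :: "real set \<Rightarrow> (real \<Rightarrow> complex) \<Rightarrow> real \<Rightarrow> complex" where
  "reflect_curve I x = restrict (\<lambda>t. - x (- t)) I"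

lemma section_on_reflect_curve:
  assumes s: "s = 1 \<or> s = - 1" and x: "section_on (zeros k1 k2 s) I x"
    and J: "\<And>t. t \<in> J \<Longrightarrow> - t \<in> I"
  shows "section_on (zeros k1 k2 s) J (reflect_curve J x)"
proof -
  have "continuous_on J (\<lambda>t. - x (- t))"
    by (rule continuous_on_minus, rule continuous_on_compose2[of I x])
      (use x J in \<open>auto simp: section_on_def intro!: continuous_intros\<close>)
  then have "continuous_on J (reflect_curve J x)"
    by (subst continuous_on_cong[OF refl]) (auto simp: reflect_curve_def)
  moreover have "reflect_curve J x t \<in> zeros k1 k2 s t" if "t \<in> J" for t
    using J[OF that] that x F_minus[OF s, of k1 k2 "x (- t)" "- t"]
    by (auto simp: reflect_curve_def section_on_def zeros_def)
  ultimately show ?thesis by (simp add: section_on_def)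
qed

lemma future_domain_iff: "t \<in> future_domain k1 k2 s \<longleftrightarrow> - t \<in> past_domain k1 k2 s"
  by (auto simp: future_domain_def past_domain_def)

lemma zero_curve_reflect:
  assumes k: "0 < k1" "k1 < k2" and s: "s = 1 \<or> s = - 1"
  shows "zero_curve k1 k2 s (past_domain k1 k2 s) x \<Longrightarrow>
           zero_curve k1 k2 s (future_domain k1 k2 s) (reflect_curve (future_domain k1 k2 s) x)"
    and "zero_curve k1 k2 s (future_domain k1 k2 s) x \<Longrightarrow>
           zero_curve k1 k2 s (past_domain k1 k2 s) (reflect_curve (past_domain k1 k2 s) x)"
proof -
  have D: "\<not> double_zero k1 k2 s x t" if "t \<in> past_domain k1 k2 s \<or> t \<in> future_domain k1 k2 s" for x t
    using no_double_zero[OF k s that] .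
  have 1: "zero_curve k1 k2 s (past_domain k1 k2 s) x \<longleftrightarrow>
      x \<in> extensional (past_domain k1 k2 s) \<and> section_on (zeros k1 k2 s) (past_domain k1 k2 s) x" for x
    by (rule zero_curve_iff_section[OF k s past_domain_props(1)]) (use D in blast)
  have 2: "zero_curve k1 k2 s (future_domain k1 k2 s) x \<longleftrightarrow>
      x \<in> extensional (future_domain k1 k2 s) \<and> section_on (zeros k1 k2 s) (future_domain k1 k2 s) x" for x
    by (rule zero_curve_iff_section[OF k s open_future_domain]) (use D in blast)
  show "zero_curve k1 k2 s (future_domain k1 k2 s) (reflect_curve (future_domain k1 k2 s) x)"
    if "zero_curve k1 k2 s (past_domain k1 k2 s) x"
    using that section_on_reflect_curve[OF s, of k1 k2 "past_domain k1 k2 s" x "future_domain k1 k2 s"]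
    unfolding 1 2 by (auto simp: reflect_curve_def future_domain_iff)
  show "zero_curve k1 k2 s (past_domain k1 k2 s) (reflect_curve (past_domain k1 k2 s) x)"
    if "zero_curve k1 k2 s (future_domain k1 k2 s) x"
    using that section_on_reflect_curve[OF s, of k1 k2 "future_domain k1 k2 s" x "past_domain k1 k2 s"]
    unfolding 1 2 by (auto simp: reflect_curve_def future_domain_iff)
qed

lemma reflect_curve_twice:
  assumes "x \<in> extensional J" and "\<And>t. t \<in> J \<Longrightarrow> - t \<in> I"
  shows "reflect_curve J (reflect_curve I x) = x"
  using assms by (auto simp: reflect_curve_def extensional_def restrict_def fun_eq_iff)

lemma reflect_curve_limit:
  assumes "\<And>t. c' t = - c (- t)" and "{0<..} \<subseteq> J"
  shows "((\<lambda>t. reflect_curve J x t - c' t) \<longlongrightarrow> 0) at_top \<longleftrightarrow> ((\<lambda>t. x t - c t) \<longlongrightarrow> 0) at_bot"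
proof -
  have "((\<lambda>t. x t - c t) \<longlongrightarrow> 0) at_bot \<longleftrightarrow> ((\<lambda>t. x (- t) - c (- t)) \<longlongrightarrow> 0) at_top"
    by (rule filterlim_at_bot_mirror)
  also have "\<dots> \<longleftrightarrow> ((\<lambda>t. - (x (- t) - c (- t))) \<longlongrightarrow> 0) at_top"
    using tendsto_minus_cancel_left[of "\<lambda>t. x (- t) - c (- t)" 0 at_top] by simp
  also have "\<dots> \<longleftrightarrow> ((\<lambda>t. reflect_curve J x t - c' t) \<longlongrightarrow> 0) at_top"
  proof (rule filterlim_cong[OF refl refl])
    show "\<forall>\<^sub>F t in at_top. - (x (- t) - c (- t)) = reflect_curve J x t - c' t"
      using eventually_gt_at_top[of 0]
      by eventually_elim (use assms in \<open>auto simp: reflect_curve_def subset_iff\<close>)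
  qed
  finally show ?thesis by simp
qed

text \<open>The centers for \<open>t \<rightarrow> \<infinity>\<close> are the reflected centers \<open>- past_center k1 k2 i (- t)\<close>; reflection is a bijection of curves.\<close>

lemma future_curves:
  assumes k: "0 < k1" "k1 < k2" and s: "s = 1 \<or> s = - 1"
  shows "odd (snd i) \<Longrightarrow> \<exists>!x. zero_curve k1 k2 s (future_domain k1 k2 s) x \<and>
           ((\<lambda>t. x t - - past_center k1 k2 i (- t)) \<longlongrightarrow> 0) at_top"
    and "zero_curve k1 k2 s (future_domain k1 k2 s) x \<Longrightarrow>
           \<exists>i. odd (snd i) \<and> ((\<lambda>t. x t - - past_center k1 k2 i (- t)) \<longlongrightarrow> 0) at_top"
proof -
  let ?I = "past_domain k1 k2 s" and ?J = "future_domain k1 k2 s"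
  have J: "{0<..} \<subseteq> ?J" by (auto simp: future_domain_def)
  have lim: "((\<lambda>t. reflect_curve ?J x t - - past_center k1 k2 i (- t)) \<longlongrightarrow> 0) at_top \<longleftrightarrow>
      ((\<lambda>t. x t - past_center k1 k2 i t) \<longlongrightarrow> 0) at_bot" for x i
    by (rule reflect_curve_limit[OF refl J])
  have twice: "reflect_curve ?J (reflect_curve ?I x) = x" if "zero_curve k1 k2 s ?J x" for x
    by (rule reflect_curve_twice) (use that in \<open>auto simp: zero_curve_def future_domain_iff\<close>)
  show "\<exists>!x. zero_curve k1 k2 s ?J x \<and> ((\<lambda>t. x t - - past_center k1 k2 i (- t)) \<longlongrightarrow> 0) at_top"
    if i: "odd (snd i)"
  proof -
    obtain x where x: "zero_curve k1 k2 s ?I x" "((\<lambda>t. x t - past_center k1 k2 i t) \<longlongrightarrow> 0) at_bot"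
      and uniq: "\<And>y. zero_curve k1 k2 s ?I y \<Longrightarrow> ((\<lambda>t. y t - past_center k1 k2 i t) \<longlongrightarrow> 0) at_bot \<Longrightarrow> y = x"
      using past_curves(1)[OF k s i] by blast
    show ?thesis
    proof (rule ex1I[of _ "reflect_curve ?J x"])
      show "zero_curve k1 k2 s ?J (reflect_curve ?J x) \<and>
          ((\<lambda>t. reflect_curve ?J x t - - past_center k1 k2 i (- t)) \<longlongrightarrow> 0) at_top"
        using zero_curve_reflect(1)[OF k s x(1)] x(2) lim by blast
      fix y assume y: "zero_curve k1 k2 s ?J y \<and> ((\<lambda>t. y t - - past_center k1 k2 i (- t)) \<longlongrightarrow> 0) at_top"
      have "((\<lambda>t. reflect_curve ?I y t - past_center k1 k2 i t) \<longlongrightarrow> 0) at_bot"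
        using y lim[of "reflect_curve ?I y" i] twice[of y] by simp
      then have "reflect_curve ?I y = x"
        using y uniq zero_curve_reflect(2)[OF k s] by blast
      then show "y = reflect_curve ?J x" using twice[of y] y by auto
    qed
  qed
  show "\<exists>i. odd (snd i) \<and> ((\<lambda>t. x t - - past_center k1 k2 i (- t)) \<longlongrightarrow> 0) at_top"
    if x: "zero_curve k1 k2 s ?J x"
    using past_curves(2)[OF k s zero_curve_reflect(2)[OF k s x]] lim[of "reflect_curve ?I x"] twice[OF x]
    by simp
qed

theorem theorem4p1:
  fixes k1 k2 :: real and s :: int
  assumes "0 < k1" and "k1 < k2" and "s = 1 \<or> s = - 1"
  shows
    "(\<forall>m::int. odd m \<longrightarrow>
        (\<exists>!x. zero_curve k1 k2 s (past_domain k1 k2 s) x \<and>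
              (\<lambda>t. x t - slow_past k1 k2 m t) \<in> o[at_bot](\<lambda>_. 1))) \<and>
     (\<forall>m::int. odd m \<longrightarrow>
        (\<exists>!x. zero_curve k1 k2 s (future_domain k1 k2 s) x \<and>
              (\<lambda>t. x t - slow_future k1 k2 m t) \<in> o[at_top](\<lambda>_. 1))) \<and>
     (\<forall>n::int. odd n \<longrightarrow>
        (\<exists>!x. zero_curve k1 k2 s (past_domain k1 k2 s) x \<and>
              (\<lambda>t. x t - fast_past k1 k2 n t) \<in> o[at_bot](\<lambda>_. 1))) \<and>
     (\<forall>n::int. odd n \<longrightarrow>
        (\<exists>!x. zero_curve k1 k2 s (future_domain k1 k2 s) x \<and>
              (\<lambda>t. x t - fast_future k1 k2 n t) \<in> o[at_top](\<lambda>_. 1))) \<and>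
     (\<forall>x. zero_curve k1 k2 s (past_domain k1 k2 s) x \<longrightarrow>
        (\<exists>m::int. odd m \<and> (\<lambda>t. x t - slow_past k1 k2 m t) \<in> o[at_bot](\<lambda>_. 1)) \<or>
        (\<exists>n::int. odd n \<and> (\<lambda>t. x t - fast_past k1 k2 n t) \<in> o[at_bot](\<lambda>_. 1))) \<and>
     (\<forall>x. zero_curve k1 k2 s (future_domain k1 k2 s) x \<longrightarrow>
        (\<exists>m::int. odd m \<and> (\<lambda>t. x t - slow_future k1 k2 m t) \<in> o[at_top](\<lambda>_. 1)) \<or>
        (\<exists>n::int. odd n \<and> (\<lambda>t. x t - fast_future k1 k2 n t) \<in> o[at_top](\<lambda>_. 1)))"
proof -
  note k = assms(1,2) and s = assms(3)
  have past: "past_center k1 k2 (True, m) = slow_past k1 k2 m"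
    "past_center k1 k2 (False, m) = fast_past k1 k2 m" for m
    by (simp_all add: past_center_def)
  have future: "(\<lambda>t. - past_center k1 k2 (True, m) (- t)) = slow_future k1 k2 m"
    "(\<lambda>t. - past_center k1 k2 (False, m) (- t)) = fast_future k1 k2 m" for m
    by (auto simp: past_center_def slow_past_def slow_future_def fast_past_def fast_future_def)
  show ?thesis
    unfolding smallo_one_iff
  proof (intro conjI allI impI)
    fix m :: int assume m: "odd m"
    show "\<exists>!x. zero_curve k1 k2 s (past_domain k1 k2 s) x \<and>
        ((\<lambda>t. x t - slow_past k1 k2 m t) \<longlongrightarrow> 0) at_bot"
      using past_curves(1)[OF k s, of "(True, m)"] m by (simp add: past)
    show "\<exists>!x. zero_curve k1 k2 s (past_domain k1 k2 s) x \<and>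
        ((\<lambda>t. x t - fast_past k1 k2 m t) \<longlongrightarrow> 0) at_bot"
      using past_curves(1)[OF k s, of "(False, m)"] m by (simp add: past)
    show "\<exists>!x. zero_curve k1 k2 s (future_domain k1 k2 s) x \<and>
        ((\<lambda>t. x t - slow_future k1 k2 m t) \<longlongrightarrow> 0) at_top"
      using future_curves(1)[OF k s, of "(True, m)"] m by (simp add: future[THEN fun_cong])
    show "\<exists>!x. zero_curve k1 k2 s (future_domain k1 k2 s) x \<and>
        ((\<lambda>t. x t - fast_future k1 k2 m t) \<longlongrightarrow> 0) at_top"
      using future_curves(1)[OF k s, of "(False, m)"] m by (simp add: future[THEN fun_cong])
  next
    fix x assume "zero_curve k1 k2 s (past_domain k1 k2 s) x"
    from past_curves(2)[OF k s this] obtain b m where "odd m"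
      "((\<lambda>t. x t - past_center k1 k2 (b, m) t) \<longlongrightarrow> 0) at_bot" by force
    then show "(\<exists>m. odd m \<and> ((\<lambda>t. x t - slow_past k1 k2 m t) \<longlongrightarrow> 0) at_bot) \<or>
        (\<exists>n. odd n \<and> ((\<lambda>t. x t - fast_past k1 k2 n t) \<longlongrightarrow> 0) at_bot)"
      by (cases b) (auto simp: past)
  next
    fix x assume "zero_curve k1 k2 s (future_domain k1 k2 s) x"
    from future_curves(2)[OF k s this] obtain b m where "odd m"
      "((\<lambda>t. x t - - past_center k1 k2 (b, m) (- t)) \<longlongrightarrow> 0) at_top" by force
    then show "(\<exists>m. odd m \<and> ((\<lambda>t. x t - slow_future k1 k2 m t) \<longlongrightarrow> 0) at_top) \<or>
        (\<exists>n. odd n \<and> ((\<lambda>t. x t - fast_future k1 k2 n t) \<longlongrightarrow> 0) at_top)"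
      by (cases b) (auto simp: future[THEN fun_cong])
  qed
qed

end
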